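(* Let $\mathcal{A}=\{\mathbf{a}_1,\dots,\mathbf{a}_n\}\subset\mathbb{N}^d$ and let $C=f_{\mathcal{A}}((0,1)^d)\subset\mathbb{R}^n$ be the corresponding open toric cube. Then $C$ is the graph of a monotone map.
   Context: For $\mathcal{A}=\{\mathbf{a}_1,\dots,\mathbf{a}_n\}\subset\mathbb{N}^d$, $f_{\mathcal{A}}:[0,1]^d\to[0,1]^n$ is the map $\mathbf{t}=(t_1,\dots,t_d)\mapsto(\mathbf{t}^{\mathbf{a}_1},\dots,\mathbf{t}^{\mathbf{a}_n})$, where $\mathbf{t}^{\mathbf{a}_i}=t_1^{a_{i,1}}\cdots t_d^{a_{i,d}}$. The image $f_{\mathcal{A}}((0,1)^d)$ is an open toric cube (it need not be open in $\mathbb{R}^n$). All sets here are semialgebraic (the o-minimal structure of semialgebraic sets). Semi-monotone sets: the empty set counts as connected; a coordinate cone in $\mathbb{R}^N$ is a set $\{z\mid z_{j_1}\sigma_1c_1,\dots,z_{j_m}\sigma_mc_m\}$ with $\sigma_i\in\{<,=,>\}$, $c_i\in\mathbb{R}$, $0\le m\le N$, distinct indices; an affine coordinate subspace is one with all $\sigma_i$ equal to "$=$". A set is semi-monotone if it is open, bounded, definable, and its intersection with every coordinate cone is connected. Monotone functions: a definable $f$ on a non-empty semi-monotone $X\subset\mathbb{R}^m$ is monotone if the sets $\{f<b\}$ and $\{f>b\}$ are semi-monotone for all $b$ (with $f$ bounded and continuous) and, for each $j$, $f$ is strictly increasing in, strictly decreasing in, or independent of $x_j$ (in the usual sense of comparing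 points differing only in the $j$-th coordinate). Monotone maps $\mathbf{f}=(f_1,\dots,f_k):X\to\mathbb{R}^k$ on a non-empty semi-monotone $X\subset\mathbb{R}^m$ (continuous, bounded, graph $\mathbf{F}$): a basis set is a set of $m$ coordinates among $x_1,\dots,x_m,y_1,\dots,y_k$ such that the corresponding map (coordinate functions $x_j$ and components $f_i$) is injective on $X$; $\mathbf{f}$ is monotone, by induction on $m$, if for $m=1$ each $f_i$ is a monotone function, and for $m>1$, for every $i,j$ with $f_i$ not independent of $x_j$: (i) each non-empty $\mathbf{F}\cap\{y_i=b\}$ is the graph of a monotone map $\mathbf{f}_{i,j,b}$ from a semi-monotone subset of the span of $\{x_1,\dots,x_m\}\setminus\{x_j\}$ to the span of $y_1,\dots,y_{i-1},x_j,y_{i+1},\dots,y_k$; (ii) the system of basis sets of $\mathbf{f}_{i,j,b}$ does not depend on $b$. A subset $G$ of a Euclidean space with coordinates $z_1,\dots,z_N$ is called the graph of a monotone map if the coordinates can be split into a set $A$ and its complement $B$ such that $G=\{(u,g(u))\mid u\in Y\}$ for a non-empty semi-monotone $Y$ in the span of the coordinates in $A$ and a monotone map $g:Y\to$ span of the coordinates in $B$ (coordinates constant on $G$ may be included among the $B$-coordinates as constant components). *)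

theory Defs
  imports "HOL-Analysis.Analysis"
begin

text \<open>
  The coordinates of a Euclidean space are the elements of a finite type \<open>'n\<close>. The span of the
  coordinates in \<open>A\<close> is the subspace of vectors vanishing outside \<open>A\<close>, so that for disjoint \<open>A\<close>
  and \<open>B\<close> the pair \<open>(u, v)\<close> of \<open>u\<close> in the span of \<open>A\<close> and \<open>v\<close> in the span of \<open>B\<close> is \<open>u + v\<close>.
  All coordinate spaces met in the induction defining monotone maps live in one space this way.
\<close>

definition coord_space :: "'n::finite set \<Rightarrow> (real^'n) set" where
  "coord_space A = {x. \<forall>i. i \<notin> A \<longrightarrow> x $ i = 0}"

inductive semialgebraic :: "'a::euclidean_space set \<Rightarrow> bool" where
  "real_polynomial_function p \<Longrightarrow> semialgebraic {x. p x > 0}"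
| "semialgebraic S \<Longrightarrow> semialgebraic (- S)"
| "semialgebraic S \<Longrightarrow> semialgebraic T \<Longrightarrow> semialgebraic (S \<union> T)"

definition coordinate_cone :: "'n::finite set \<Rightarrow> (real^'n) set \<Rightarrow> bool" where
  "coordinate_cone A K \<longleftrightarrow>
     (\<exists>J \<sigma> c. J \<subseteq> A \<and> (\<forall>j\<in>J. \<sigma> j \<in> {(<), (=), (>)}) \<and>
        K = {z \<in> coord_space A. \<forall>j\<in>J. \<sigma> j (z $ j) (c j)})"

text \<open>
  A subset of a coordinate subspace is semialgebraic there iff it is semialgebraic in the whole
  space, whereas openness has to be taken relative to the subspace.
\<close>

definition semi_monotone :: "'n::finite set \<Rightarrow> (real^'n) set \<Rightarrow> bool" where
  "semi_monotone A X \<longleftrightarrow>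
     openin (top_of_set (coord_space A)) X \<and> bounded X \<and> semialgebraic X \<and>
     (\<forall>K. coordinate_cone A K \<longrightarrow> connected (X \<inter> K))"

definition differ_only_at :: "'n::finite \<Rightarrow> real^'n \<Rightarrow> real^'n \<Rightarrow> bool" where
  "differ_only_at j x y \<longleftrightarrow> (\<forall>k. k \<noteq> j \<longrightarrow> x $ k = y $ k)"

definition strictly_increasing_in :: "(real^'n::finite) set \<Rightarrow> (real^'n \<Rightarrow> real) \<Rightarrow> 'n \<Rightarrow> bool" where
  "strictly_increasing_in X f j \<longleftrightarrow>
     (\<forall>x\<in>X. \<forall>y\<in>X. differ_only_at j x y \<and> x $ j < y $ j \<longrightarrow> f x < f y)"

definition strictly_decreasing_in :: "(real^'n::finite) set \<Rightarrow> (real^'n \<Rightarrow> real) \<Rightarrow> 'n \<Rightarrow> bool" where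
  "strictly_decreasing_in X f j \<longleftrightarrow>
     (\<forall>x\<in>X. \<forall>y\<in>X. differ_only_at j x y \<and> x $ j < y $ j \<longrightarrow> f x > f y)"

definition independent_of :: "(real^'n::finite) set \<Rightarrow> (real^'n \<Rightarrow> real) \<Rightarrow> 'n \<Rightarrow> bool" where
  "independent_of X f j \<longleftrightarrow>
     (\<forall>x\<in>X. \<forall>y\<in>X. differ_only_at j x y \<longrightarrow> f x = f y)"

definition monotone_function ::
    "'n::finite set \<Rightarrow> (real^'n) set \<Rightarrow> (real^'n \<Rightarrow> real) \<Rightarrow> bool" where
  "monotone_function A X f \<longleftrightarrow>
     X \<noteq> {} \<and> semi_monotone A X \<and>
     semialgebraic ((\<lambda>x. (x, f x)) ` X) \<and> bounded (f ` X) \<and> continuous_on X f \<and>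
     (\<forall>b. semi_monotone A {x\<in>X. f x < b} \<and> semi_monotone A {x\<in>X. f x > b}) \<and>
     (\<forall>j\<in>A. strictly_increasing_in X f j \<or> strictly_decreasing_in X f j \<or> independent_of X f j)"

definition map_graph :: "(real^'n::finite) set \<Rightarrow> (real^'n \<Rightarrow> real^'n) \<Rightarrow> (real^'n) set" where
  "map_graph X f = (\<lambda>x. x + f x) ` X"

text \<open>
  Maps from a subset of the span of \<open>A\<close> to the span of \<open>B\<close>. The coordinate \<open>s\<close> of \<open>x + f x\<close> is the
  coordinate function \<open>x $ s\<close> for \<open>s\<close> in \<open>A\<close>, and the component \<open>f x $ s\<close> for \<open>s\<close> in \<open>B\<close>.
\<close>

definition basis_sets ::
    "'n::finite set \<Rightarrow> 'n set \<Rightarrow> (real^'n) set \<Rightarrow> (real^'n \<Rightarrow> real^'n) \<Rightarrow> 'n set set" where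
  "basis_sets A B X f =
     {S. S \<subseteq> A \<union> B \<and> card S = card A \<and>
         inj_on (\<lambda>x. \<chi> s. if s \<in> S then (x + f x) $ s else 0) X}"

definition admissible_map ::
    "'n::finite set \<Rightarrow> 'n set \<Rightarrow> (real^'n) set \<Rightarrow> (real^'n \<Rightarrow> real^'n) \<Rightarrow> bool" where
  "admissible_map A B X f \<longleftrightarrow>
     A \<inter> B = {} \<and> X \<noteq> {} \<and> semi_monotone A X \<and> f ` X \<subseteq> coord_space B \<and>
     continuous_on X f \<and> bounded (f ` X) \<and> semialgebraic (map_graph X f)"

text \<open>
  A map on the one-point space \<open>coord_space {}\<close> is monotone; this occurs for a toric
  cube that is a single point. In the inductive case \<open>Y b\<close> and \<open>g b\<close> are the domain
  and the map \<open>f\<^sub>i\<^sub>,\<^sub>j\<^sub>,\<^sub>b\<close> for those \<open>b\<close> whose slice is non-empty, and adding \<open>b\<close>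
  times the \<open>i\<close>-th unit vector restores the coordinate \<open>i\<close> that is constantly \<open>b\<close> on the slice.
\<close>

function monotone_map ::
    "'n::finite set \<Rightarrow> 'n set \<Rightarrow> (real^'n) set \<Rightarrow> (real^'n \<Rightarrow> real^'n) \<Rightarrow> bool" where
  "monotone_map A B X f \<longleftrightarrow>
     admissible_map A B X f \<and>
     (if card A = 0 then True
      else if card A = 1 then \<forall>i\<in>B. monotone_function A X (\<lambda>x. f x $ i)
      else \<forall>i\<in>B. \<forall>j\<in>A. \<not> independent_of X (\<lambda>x. f x $ i) j \<longrightarrow>
        (\<exists>Y g.
          (\<forall>b. map_graph X f \<inter> {z. z $ i = b} \<noteq> {} \<longrightarrow>
             monotone_map (A - {j}) (insert j (B - {i})) (Y b) (g b) \<and>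
             map_graph X f \<inter> {z. z $ i = b} =
               (\<lambda>z. z + b *\<^sub>R axis i 1) ` map_graph (Y b) (g b)) \<and>
          (\<forall>b b'. map_graph X f \<inter> {z. z $ i = b} \<noteq> {} \<and>
                  map_graph X f \<inter> {z. z $ i = b'} \<noteq> {} \<longrightarrow>
             basis_sets (A - {j}) (insert j (B - {i})) (Y b) (g b) =
             basis_sets (A - {j}) (insert j (B - {i})) (Y b') (g b'))))"
  by pat_completeness auto
termination
  by (relation "Wellfounded.measure (\<lambda>(A, _). card A)") (auto simp del: card_Diff_insert simp: card_Diff1_less card_gt_0_iff)

declare monotone_map.simps [simp del]

definition graph_of_monotone_map :: "(real^'n::finite) set \<Rightarrow> bool" where
  "graph_of_monotone_map G \<longleftrightarrow> (\<exists>A Y g. monotone_map A (- A) Y g \<and> G = map_graph Y g)"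

definition toric_map :: "('n::finite \<Rightarrow> nat^'d::finite) \<Rightarrow> real^'d \<Rightarrow> real^'n" where
  "toric_map a t = (\<chi> i. \<Prod>j\<in>UNIV. (t $ j) ^ (a i $ j))"

definition open_toric_cube :: "('n::finite \<Rightarrow> nat^'d::finite) \<Rightarrow> (real^'n) set" where
  "open_toric_cube a = toric_map a ` {t. \<forall>j. 0 < t $ j \<and> t $ j < 1}"

end

theory Submission
  imports Defs
begin

text \<open>
  In logarithmic coordinates the toric cube is the image of the open negative orthant under a
  linear map with rational entries. Eliminating the parameters one at a time, by a pivot when some
  dependent coordinate involves the parameter and by Fourier-Motzkin elimination otherwise, writes
  this image as the graph of an affine map over an open convex polyhedron with rational normals.
  Exponentiating, rational linear inequalities become polynomial ones, and coordinate cones cut the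
  polyhedron in convex, hence connected, sets. The class of such graphs is closed under slicing by
  \<open>z\<^sub>i = b\<close>: pivot to make \<open>z\<^sub>i\<close> an independent coordinate, then fix it. This only changes constant
  terms with \<open>b\<close>, and basis sets depend only on the linear part.
\<close>

section \<open>Elimination of variables\<close>

text \<open>Toric cubes are not closed under slicing: the level \<open>y = 1/4\<close> of the cube
  of all \<open>(t, t^2)\<close> is a point with \<open>x = 1/2\<close>, which no monomials with
  coefficient 1 produce. The induction therefore runs over a larger class, whose constants
  \<open>c\<close> and bounds in \<open>H\<close> are arbitrary reals. The slopes have to stay
  rational: clearing denominators turns them into integer exponents, whereas an irrational exponent
  would in general leave the semialgebraic sets. A real constant merely becomes a positive real
  coefficient. New slopes arise from old ones by field operations, so rationality survives every
  step. Boundedness cannot be read off from this data directly; it is carried along as a hypothesis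
  on the whole graph and passes to slices, which are translates of subsets.\<close>

definition log_cell ::
    "'k set \<Rightarrow> 'k set \<Rightarrow> ('k \<Rightarrow> 'k \<Rightarrow> real) \<Rightarrow> ('k \<Rightarrow> real) \<Rightarrow> (('k \<Rightarrow> real) \<times> real) set \<Rightarrow> ('k \<Rightarrow> real) set" where
  "log_cell A B r c H =
     {w. (\<forall>i\<in>B. w i = c i + (\<Sum>k\<in>A. r i k * w k)) \<and> (\<forall>(m, e)\<in>H. (\<Sum>k\<in>A. m k * w k) < e)}"

text \<open>Rationality is asked of every entry, also at indices outside \<open>A\<close> and
  \<open>B\<close>, so that it does not have to be tracked when these sets change.\<close>

definition rational_data :: "('k \<Rightarrow> 'k \<Rightarrow> real) \<Rightarrow> (('k \<Rightarrow> real) \<times> real) set \<Rightarrow> bool" where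
  "rational_data r H \<longleftrightarrow> (\<forall>i k. r i k \<in> \<rat>) \<and> finite H \<and> (\<forall>(m, e)\<in>H. \<forall>k. m k \<in> \<rat>)"

text \<open>The equation is solved for \<open>w j\<close> and substituted into a linear form. With
  \<open>m\<close> arbitrary, one computation serves the other rows, the inequalities and, taking
  \<open>m\<close> to be the indicator of \<open>j\<close>, the new row of \<open>j\<close>.\<close>

lemma pivot_sum:
  fixes w :: "'k \<Rightarrow> real"
  assumes "finite A" "j \<in> A" "i \<notin> A" "\<rho> j \<noteq> 0"
    and w: "w i = \<gamma> + (\<Sum>k\<in>A. \<rho> k * w k)"
  shows "(\<Sum>k\<in>A. m k * w k) = - m j * \<gamma> / \<rho> j +
    (\<Sum>k\<in>insert i (A - {j}). (if k = i then m j / \<rho> j else m k - m j * \<rho> k / \<rho> j) * w k)"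
proof -
  have 1: "(\<Sum>k\<in>A. m k * w k) = m j * w j + (\<Sum>k\<in>A - {j}. m k * w k)"
    using assms by (simp add: sum.remove)
  have "w i = \<gamma> + (\<rho> j * w j + (\<Sum>k\<in>A - {j}. \<rho> k * w k))"
    using assms by (simp add: sum.remove)
  then have 2: "w j = (w i - \<gamma> - (\<Sum>k\<in>A - {j}. \<rho> k * w k)) / \<rho> j"
    using assms by (simp add: field_simps)
  have 3: "(\<Sum>k\<in>insert i (A - {j}). (if k = i then m j / \<rho> j else m k - m j * \<rho> k / \<rho> j) * w k)
     = m j / \<rho> j * w i + (\<Sum>k\<in>A - {j}. (if k = i then m j / \<rho> j else m k - m j * \<rho> k / \<rho> j) * w k)"
    using assms by simp
  have 4: "(\<Sum>k\<in>A - {j}. (if k = i then m j / \<rho> j else m k - m j * \<rho> k / \<rho> j) * w k)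
     = (\<Sum>k\<in>A - {j}. m k * w k - m j / \<rho> j * (\<rho> k * w k))"
    using assms by (intro sum.cong) (auto simp: algebra_simps)
  have 5: "\<dots> = (\<Sum>k\<in>A - {j}. m k * w k) - m j / \<rho> j * (\<Sum>k\<in>A - {j}. \<rho> k * w k)"
    by (simp only: sum_subtractf sum_distrib_left)
  show ?thesis
    unfolding 1 3 4 5 2 using assms by (simp add: field_simps)
qed

text \<open>An exchange step as in Gauss-Jordan elimination or the simplex method. The only division
  is by \<open>r i j\<close>, so rational slopes stay rational.\<close>

lemma log_cell_pivot:
  assumes fin: "finite A" and disj: "A \<inter> B = {}" and i: "i \<in> B" and j: "j \<in> A"
    and nz: "r i j \<noteq> 0" and rat: "rational_data r H"
  obtains r' c' H' where "rational_data r' H'"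
    "log_cell A B r c H = log_cell (insert i (A - {j})) (insert j (B - {i})) r' c' H'"
proof -
  define sub where
    "sub m k = (if k = i then m j / r i j else m k - m j * r i k / r i j)" for m k
  define q where "q m = - m j * c i / r i j" for m
  define \<delta> :: "'a \<Rightarrow> real" where "\<delta> k = (if k = j then 1 else 0)" for k
  define r' where "r' i' = sub (if i' = j then \<delta> else r i')" for i'
  define c' where "c' i' = (if i' = j then q \<delta> else c i' + q (r i'))" for i'
  define H' where "H' = (\<lambda>(m, e). (sub m, e - q m)) ` H"
  let ?A = "insert i (A - {j})"
  have iA: "i \<notin> A" and jB: "j \<notin> B" using disj i j by auto
  have sum: "(\<Sum>k\<in>A. m k * w k) = q m + (\<Sum>k\<in>?A. sub m k * w k)"
    if "w i = c i + (\<Sum>k\<in>A. r i k * w k)" for m w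
    unfolding q_def sub_def by (rule pivot_sum[where \<rho> = "r i", OF fin j iA nz that])
  have delta: "(\<Sum>k\<in>A. \<delta> k * w k) = w j" for w
    unfolding \<delta>_def using fin j by (simp add: if_distrib[of "\<lambda>x. x * _"] cong: if_cong)
  \<comment> \<open>\<open>sum\<close> is available only where the old equation of \<open>i\<close>
    holds, so the way back from the new equation of \<open>j\<close> to the old one is computed
    separately.\<close>
  have \<delta>i: "w i = c i + (\<Sum>k\<in>A. r i k * w k) \<longleftrightarrow> w j = c' j + (\<Sum>k\<in>?A. r' j k * w k)" for w
  proof
    assume "w i = c i + (\<Sum>k\<in>A. r i k * w k)"
    from sum[OF this, of \<delta>] show "w j = c' j + (\<Sum>k\<in>?A. r' j k * w k)"
      by (simp only: delta c'_def r'_def if_True simp_thms)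
  next
    assume a: "w j = c' j + (\<Sum>k\<in>?A. r' j k * w k)"
    have "(\<Sum>k\<in>A - {j}. r' j k * w k) = (\<Sum>k\<in>A - {j}. - (r i k * w k) / r i j)"
      using iA by (intro sum.cong) (auto simp: r'_def sub_def \<delta>_def)
    then have "(\<Sum>k\<in>?A. r' j k * w k) = w i / r i j - (\<Sum>k\<in>A - {j}. r i k * w k) / r i j"
      using fin iA by (simp add: sum_divide_distrib[symmetric] sum_negf)
        (simp add: r'_def sub_def \<delta>_def)
    with a have "r i j * w j = w i - c i - (\<Sum>k\<in>A - {j}. r i k * w k)"
      using nz by (simp add: c'_def q_def \<delta>_def field_simps)
    then show "w i = c i + (\<Sum>k\<in>A. r i k * w k)"
      using fin j by (simp add: sum.remove)
  qed
  have "log_cell A B r c H = log_cell ?A (insert j (B - {i})) r' c' H'"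
  proof (intro set_eqI)
    fix w
    show "w \<in> log_cell A B r c H \<longleftrightarrow> w \<in> log_cell ?A (insert j (B - {i})) r' c' H'"
    proof (cases "w i = c i + (\<Sum>k\<in>A. r i k * w k)")
      case True
      have "w i' = c i' + (\<Sum>k\<in>A. r i' k * w k) \<longleftrightarrow> w i' = c' i' + (\<Sum>k\<in>?A. r' i' k * w k)"
        if "i' \<in> B" for i'
        using that jB sum[OF True, of "r i'"] by (auto simp: c'_def r'_def simp del: sum.insert)
      moreover have "(\<forall>(m, e)\<in>H. (\<Sum>k\<in>A. m k * w k) < e) \<longleftrightarrow>
          (\<forall>(m, e)\<in>H'. (\<Sum>k\<in>?A. m k * w k) < e)"
        unfolding H'_def using sum[OF True]
        by (auto simp add: less_diff_eq add.commute simp del: sum.insert split: prod.splits)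
      ultimately show ?thesis
        using True \<delta>i[of w] unfolding log_cell_def by (auto simp del: sum.insert)
    next
      case False
      then show ?thesis using \<delta>i[of w] i unfolding log_cell_def by (auto simp del: sum.insert)
    qed
  qed
  moreover have "rational_data r' H'"
  proof -
    have s: "sub m k \<in> \<rat>" if "\<And>k. m k \<in> \<rat>" for m k
      using that rat by (auto simp: sub_def rational_data_def)
    have "r' i' k \<in> \<rat>" for i' k
      unfolding r'_def by (rule s) (use rat in \<open>auto simp: rational_data_def \<delta>_def\<close>)
    then show ?thesis
      using rat s unfolding rational_data_def H'_def by fastforce
  qed
  ultimately show thesis using that by blast
qed

section \<open>Fourier-Motzkin elimination\<close>

lemma exists_between_finite_reals:
  fixes L U :: "real set"
  assumes "finite L" "finite U" "\<And>l u. l \<in> L \<Longrightarrow> u \<in> U \<Longrightarrow> l < u"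
  shows "\<exists>s. (\<forall>l\<in>L. l < s) \<and> (\<forall>u\<in>U. s < u)"
proof (cases "L = {} \<or> U = {}")
  \<comment> \<open>With one side empty, any number beyond the finitely many bounds on the other
    side works; in the elimination this is a coordinate bounded on at most one side.\<close>
  case True
  then show ?thesis
  proof
    assume "L = {}"
    moreover obtain u where "\<forall>x\<in>U. u \<le> x"
      using bdd_below_finite[OF assms(2)] unfolding bdd_below_def by blast
    ultimately show ?thesis by (intro exI[of _ "u - 1"]) auto
  next
    assume "U = {}"
    moreover obtain l where "\<forall>x\<in>L. x \<le> l"
      using bdd_above_finite[OF assms(1)] unfolding bdd_above_def by blast
    ultimately show ?thesis by (intro exI[of _ "l + 1"]) auto
  qed
next
  case False
  then have "Max L < Min U" using assms by simp
  then obtain s where "Max L < s" "s < Min U" using dense by blast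
  then show ?thesis using False assms by (intro exI[of _ s]) auto
qed

text \<open>For fixed other coordinates each inequality bounds \<open>s\<close> from below, from
  above or not at all, according to the sign of \<open>m j\<close>. A suitable \<open>s\<close>
  exists iff every lower bound is less than every upper bound.\<close>

lemma fourier_motzkin:
  fixes H :: "(('k \<Rightarrow> real) \<times> real) set"
  assumes fin: "finite A" and j: "j \<in> A" and H: "finite H" "\<forall>(m, e)\<in>H. \<forall>k. m k \<in> \<rat>"
  obtains H' where "finite H'" "\<forall>(m, e)\<in>H'. \<forall>k. m k \<in> \<rat>"
    "\<And>w. (\<exists>s. \<forall>(m, e)\<in>H. (\<Sum>k\<in>A. m k * (w(j := s)) k) < e) \<longleftrightarrow>
          (\<forall>(m, e)\<in>H'. (\<Sum>k\<in>A - {j}. m k * w k) < e)"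
proof -
  define N where "N = {h \<in> H. fst h j < 0}"
  define P where "P = {h \<in> H. fst h j > 0}"
  define Z where "Z = {h \<in> H. fst h j = 0}"
  \<comment> \<open>The multipliers \<open>m' j\<close> and \<open>- m j\<close> are positive for a
    pair from \<open>N\<close> and \<open>P\<close>, and they cancel the coefficient of
    \<open>j\<close>.\<close>
  define comb where "comb = (\<lambda>((m :: 'k \<Rightarrow> real, e :: real), (m', e')).
      (\<lambda>k. m' j * m k - m j * m' k, m' j * e - m j * e'))"
  define H' where "H' = Z \<union> comb ` (N \<times> P)"
  define S where "S m w = (\<Sum>k\<in>A - {j}. m k * w k)" for m w :: "'k \<Rightarrow> real"
  \<comment> \<open>The bound on \<open>s\<close> that results when the inequality is solved for
    it.\<close>
  define v where "v w = (\<lambda>(m, e). (e - S m w) / m j)" for w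
  have HH: "H = N \<union> P \<union> Z" unfolding N_def P_def Z_def by auto
  have fins: "finite N" "finite P" "finite Z" using H unfolding N_def P_def Z_def by auto
  have S: "(\<Sum>k\<in>A. m k * (w(j := s)) k) = m j * s + S m w" for m w s
    using fin j by (simp add: sum.remove S_def)
  have "(\<exists>s. \<forall>(m, e)\<in>H. (\<Sum>k\<in>A. m k * (w(j := s)) k) < e) \<longleftrightarrow>
          (\<forall>(m, e)\<in>H'. (\<Sum>k\<in>A - {j}. m k * w k) < e)" for w
  proof -
    have N: "fst h j * s + S (fst h) w < snd h \<longleftrightarrow> v w h < s" if "h \<in> N" for h s
      using that unfolding N_def v_def by (auto simp: field_simps case_prod_unfold)
    have P: "fst h j * s + S (fst h) w < snd h \<longleftrightarrow> s < v w h" if "h \<in> P" for h s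
      using that unfolding P_def v_def by (auto simp: field_simps case_prod_unfold)
    have Z: "fst h j * s + S (fst h) w < snd h \<longleftrightarrow> S (fst h) w < snd h" if "h \<in> Z" for h s
      using that unfolding Z_def by simp
    have C: "S (fst (comb (h, h'))) w < snd (comb (h, h')) \<longleftrightarrow> v w h < v w h'"
      if "h \<in> N" "h' \<in> P" for h h'
    proof -
      obtain m e m' e' where h: "h = (m, e)" "h' = (m', e')" by fastforce
      have neg: "m j < 0" and pos: "m' j > 0" using that h unfolding N_def P_def by auto
      have "S (fst (comb (h, h'))) w = m' j * S m w - m j * S m' w"
        unfolding S_def comb_def h by (simp add: algebra_simps sum_subtractf sum_distrib_left)
      moreover have "snd (comb (h, h')) = m' j * e - m j * e'" by (simp add: comb_def h)
      moreover have "v w h < v w h' \<longleftrightarrow> m' j * (e - S m w) > m j * (e' - S m' w)"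
        using neg pos unfolding v_def h by (simp add: field_simps)
      ultimately show ?thesis by (auto simp: algebra_simps)
    qed
    have "(\<exists>s. \<forall>(m, e)\<in>H. (\<Sum>k\<in>A. m k * (w(j := s)) k) < e) \<longleftrightarrow>
        (\<forall>(m, e)\<in>Z. S m w < e) \<and> (\<exists>s. (\<forall>l\<in>v w ` N. l < s) \<and> (\<forall>u\<in>v w ` P. s < u))"
      unfolding S HH ball_Un case_prod_unfold ball_simps(9) by (simp add: N P Z conj_commute)
    also have "(\<exists>s. (\<forall>l\<in>v w ` N. l < s) \<and> (\<forall>u\<in>v w ` P. s < u)) \<longleftrightarrow>
        (\<forall>h\<in>N. \<forall>h'\<in>P. v w h < v w h')"
    proof
      assume "\<forall>h\<in>N. \<forall>h'\<in>P. v w h < v w h'"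
      then show "\<exists>s. (\<forall>l\<in>v w ` N. l < s) \<and> (\<forall>u\<in>v w ` P. s < u)"
        by (intro exists_between_finite_reals) (use fins in auto)
    qed (blast intro: less_trans)
    also have "\<dots> \<longleftrightarrow> (\<forall>(m, e)\<in>comb ` (N \<times> P). S m w < e)"
      using C by (simp only: case_prod_unfold ball_simps(9) split_paired_Ball_Sigma cong: ball_cong)
    finally show ?thesis unfolding H'_def S_def by (simp add: ball_Un)
  qed
  moreover have "finite H'" unfolding H'_def using fins by simp
  moreover have "\<forall>(m, e)\<in>H'. \<forall>k. m k \<in> \<rat>"
    using H(2) unfolding H'_def comb_def N_def P_def Z_def by (fastforce intro!: Rats_diff Rats_mult)
  ultimately show thesis using that by blast
qed

section \<open>Coordinate projections of cells\<close>

lemma log_cell_cong: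
  assumes "\<And>k. k \<in> A \<union> B \<Longrightarrow> w k = w' k"
  shows "w \<in> log_cell A B r c H \<longleftrightarrow> w' \<in> log_cell A B r c H"
proof -
  have "(\<Sum>k\<in>A. m k * w k) = (\<Sum>k\<in>A. m k * w' k)" for m
    using assms by (intro sum.cong) auto
  then show ?thesis using assms unfolding log_cell_def by auto
qed

text \<open>No other condition reads a dependent coordinate, so its own equation can be met by the
  choice of \<open>s\<close> and then forgotten.\<close>

lemma log_cell_drop:
  assumes "j \<in> B" "j \<notin> A"
  shows "(\<exists>s. w(j := s) \<in> log_cell A B r c H) \<longleftrightarrow> w \<in> log_cell A (B - {j}) r c H"
proof -
  have *: "(\<Sum>k\<in>A. m k * (w(j := s)) k) = (\<Sum>k\<in>A. m k * w k)" for m s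
    using assms by (intro sum.cong) auto
  show ?thesis
    unfolding log_cell_def mem_Collect_eq * using assms by auto
qed

lemma log_cell_project:
  assumes fin: "finite A" and disj: "A \<inter> B = {}" and j: "j \<in> A \<union> B" and rat: "rational_data r H"
  obtains A' B' r' c' H' where "A' \<inter> B' = {}" "A' \<union> B' = A \<union> B - {j}" "rational_data r' H'"
    "\<And>w. (\<exists>s. w(j := s) \<in> log_cell A B r c H) \<longleftrightarrow> w \<in> log_cell A' B' r' c' H'"
proof -
  consider "j \<in> B" "j \<notin> A" | i where "j \<in> A" "i \<in> B" "r i j \<noteq> 0"
    | "j \<in> A" "j \<notin> B" "\<And>i. i \<in> B \<Longrightarrow> r i j = 0"
    using j disj by blast
  then show thesis
  proof cases
    case 1
    show ?thesis
      by (rule that[of A "B - {j}" r H c]) (use 1 disj rat in \<open>auto simp: log_cell_drop\<close>)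
  next
    case 2
    from log_cell_pivot[OF fin disj 2(2,1,3) rat, of c] obtain r' c' H' where
      *: "rational_data r' H'"
      "log_cell A B r c H = log_cell (insert i (A - {j})) (insert j (B - {i})) r' c' H'" .
    have "i \<noteq> j" using 2 disj by auto
    then show ?thesis
      by (intro that[of "insert i (A - {j})" "insert j (B - {i}) - {j}" r' H' c'] *(1))
         (use 2 disj in \<open>auto simp: *(2) log_cell_drop\<close>)
  next
    case 3
    from rat obtain H' where H': "finite H'" "\<forall>(m, e)\<in>H'. \<forall>k. m k \<in> \<rat>"
      "\<And>w. (\<exists>s. \<forall>(m, e)\<in>H. (\<Sum>k\<in>A. m k * (w(j := s)) k) < e) \<longleftrightarrow>
          (\<forall>(m, e)\<in>H'. (\<Sum>k\<in>A - {j}. m k * w k) < e)"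
      using fourier_motzkin[OF fin 3(1), of H] unfolding rational_data_def by blast
    have eq: "(\<Sum>k\<in>A. r i k * (w(j := s)) k) = (\<Sum>k\<in>A - {j}. r i k * w k)" if "i \<in> B" for i w s
      using 3 that fin by (simp add: sum.remove)
    have "(\<exists>s. w(j := s) \<in> log_cell A B r c H) \<longleftrightarrow> w \<in> log_cell (A - {j}) B r c H'" for w
      unfolding log_cell_def mem_Collect_eq H'(3)[symmetric] using 3(2) eq by auto
    then show ?thesis
      by (intro that[of "A - {j}" B r H' c])
         (use H' rat 3 disj in \<open>auto simp: rational_data_def\<close>)
  qed
qed

text \<open>The split of the remaining coordinates into \<open>A'\<close> and \<open>B'\<close> is
  left open: which of them become independent is decided by the pivots on the way.\<close>

lemma log_cell_project_set:
  fixes A :: "'k::finite set"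
  assumes disj: "A \<inter> B = {}" and J: "J \<subseteq> A \<union> B" and rat: "rational_data r H"
  shows "\<exists>A' B' r' c' H'. A' \<inter> B' = {} \<and> A' \<union> B' = A \<union> B - J \<and> rational_data r' H' \<and>
    (\<forall>w. (\<exists>w'\<in>log_cell A B r c H. \<forall>k. k \<notin> J \<longrightarrow> w' k = w k) \<longleftrightarrow> w \<in> log_cell A' B' r' c' H')"
  using finite[of J] J
proof (induction J rule: finite_induct)
  case empty
  have "(\<exists>w'\<in>log_cell A B r c H. \<forall>k. k \<notin> {} \<longrightarrow> w' k = w k) \<longleftrightarrow> w \<in> log_cell A B r c H" for w
    by (simp add: fun_eq_iff[symmetric])
  then show ?case using disj rat by (intro exI[of _ A] exI[of _ B] exI[of _ r] exI[of _ c] exI[of _ H]) auto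
next
  case (insert j J)
  then obtain A' B' r' c' H' where IH: "A' \<inter> B' = {}" "A' \<union> B' = A \<union> B - J" "rational_data r' H'"
    "\<And>w. (\<exists>w'\<in>log_cell A B r c H. \<forall>k. k \<notin> J \<longrightarrow> w' k = w k) \<longleftrightarrow> w \<in> log_cell A' B' r' c' H'"
    by auto
  have "j \<in> A' \<union> B'" using insert IH(2) by auto
  from log_cell_project[OF finite IH(1) this IH(3), of c'] obtain A2 B2 r2 c2 H2 where
    2: "A2 \<inter> B2 = {}" "A2 \<union> B2 = A' \<union> B' - {j}" "rational_data r2 H2"
    "\<And>w. (\<exists>s. w(j := s) \<in> log_cell A' B' r' c' H') \<longleftrightarrow> w \<in> log_cell A2 B2 r2 c2 H2" by metis
  have "(\<exists>w'\<in>log_cell A B r c H. \<forall>k. k \<notin> insert j J \<longrightarrow> w' k = w k) \<longleftrightarrow>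
      w \<in> log_cell A2 B2 r2 c2 H2" for w
  proof -
    have "(\<forall>k. k \<notin> insert j J \<longrightarrow> w' k = w k) \<longleftrightarrow> (\<exists>s. \<forall>k. k \<notin> J \<longrightarrow> w' k = (w(j := s)) k)" for w'
      by (auto intro!: exI[of _ "w' j"])
    then have "(\<exists>w'\<in>log_cell A B r c H. \<forall>k. k \<notin> insert j J \<longrightarrow> w' k = w k) \<longleftrightarrow>
      (\<exists>s. \<exists>w'\<in>log_cell A B r c H. \<forall>k. k \<notin> J \<longrightarrow> w' k = (w(j := s)) k)" by blast
    then show ?thesis by (simp only: IH(4) 2(4))
  qed
  moreover have "A2 \<union> B2 = A \<union> B - insert j J" using 2(2) IH(2) by auto
  ultimately show ?case using 2(1,3) by blast
qed

text \<open>The graph of the linear map, with parameters and image coordinates side by side in the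
  sum type, is already a cell: the parameters are independent and negative, the image coordinates
  dependent with zero constants. The image is what remains after projecting the parameters
  away.\<close>

lemma negative_orthant_image_log_cell:
  fixes M :: "'n::finite \<Rightarrow> 'd::finite \<Rightarrow> real"
  assumes M: "\<And>i j. M i j \<in> \<rat>"
  obtains A r c H where "rational_data r H"
    "{w. \<exists>t. (\<forall>j. t j < 0) \<and> (\<forall>i. w i = (\<Sum>j\<in>UNIV. M i j * t j))} = log_cell A (- A) r c H"
proof -
  define r :: "('d + 'n) \<Rightarrow> ('d + 'n) \<Rightarrow> real" where
    "r x y = (case (x, y) of (Inr i, Inl j) \<Rightarrow> M i j | _ \<Rightarrow> 0)" for x y
  define H :: "(('d + 'n \<Rightarrow> real) \<times> real) set" where
    "H = range (\<lambda>j. (\<lambda>k. if k = Inl j then 1 else 0, 0))"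
  have rat: "rational_data r H"
    using M unfolding rational_data_def r_def H_def by (auto split: sum.split)
  have sum: "(\<Sum>k\<in>range Inl. m k * w k) = (\<Sum>j\<in>UNIV. m (Inl j) * w (Inl j))"
    for m w :: "'d + 'n \<Rightarrow> real" by (simp add: sum.reindex)
  have cell: "w \<in> log_cell (range Inl) (range Inr) r (\<lambda>_. 0) H \<longleftrightarrow>
      (\<forall>j. w (Inl j) < 0) \<and> (\<forall>i. w (Inr i) = (\<Sum>j\<in>UNIV. M i j * w (Inl j)))" for w
    unfolding log_cell_def H_def mem_Collect_eq sum r_def
    by (auto simp: if_distrib[of "\<lambda>x. x * _"] cong: if_cong)
  have "range Inl \<union> range Inr - range Inl = (range Inr :: ('d + 'n) set)"
    and "range Inl \<inter> range Inr = ({} :: ('d + 'n) set)" by auto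
  with log_cell_project_set[of "range Inl" "range Inr" "range Inl" r H "\<lambda>_. 0", OF _ _ rat]
  obtain A' B' r' c' H' where *: "A' \<inter> B' = {}" "A' \<union> B' = range Inr" "rational_data r' H'"
    "\<And>w. (\<exists>w'\<in>log_cell (range Inl) (range Inr) r (\<lambda>_. 0) H. \<forall>k. k \<notin> range Inl \<longrightarrow> w' k = w k) \<longleftrightarrow>
      w \<in> log_cell A' B' r' c' H'" by (simp only: Un_upper1 simp_thms) blast
  define A where "A = Inr -` A'"
  have A': "A' = Inr ` A" using *(2) unfolding A_def by auto
  have "B' = range Inr - A'" using *(1,2) by auto
  then have B': "B' = Inr ` (- A)" unfolding A_def by auto
  define r2 where "r2 i k = r' (Inr i) (Inr k)" for i k
  define H2 where "H2 = (\<lambda>(m, e). (\<lambda>k. m (Inr k) :: real, e :: real)) ` H'"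
  have rat2: "rational_data r2 H2"
    using *(3) unfolding rational_data_def r2_def H2_def by fastforce
  have "(\<exists>t. (\<forall>j. t j < 0) \<and> (\<forall>i. w i = (\<Sum>j\<in>UNIV. M i j * t j))) \<longleftrightarrow>
      w \<in> log_cell A (- A) r2 (c' \<circ> Inr) H2" for w
  proof -
    \<comment> \<open>The value 0 at the parameters is a placeholder: these are the coordinates
      projected away.\<close>
    have "(\<exists>t. (\<forall>j. t j < 0) \<and> (\<forall>i. w i = (\<Sum>j\<in>UNIV. M i j * t j))) \<longleftrightarrow>
       (\<exists>w'\<in>log_cell (range Inl) (range Inr) r (\<lambda>_. 0) H.
          \<forall>k. k \<notin> range Inl \<longrightarrow> w' k = case_sum (\<lambda>_. 0) w k)" (is "?l \<longleftrightarrow> ?r")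
    proof
      assume ?l
      then obtain t where "\<forall>j. t j < 0" "\<forall>i. w i = (\<Sum>j\<in>UNIV. M i j * t j)" by blast
      then show ?r
        by (intro bexI[of _ "case_sum t w"]) (auto simp: cell split: sum.split)
    next
      assume ?r
      then obtain w' where w': "\<And>j. w' (Inl j) < 0"
        "\<And>i. w' (Inr i) = (\<Sum>j\<in>UNIV. M i j * w' (Inl j))"
        "\<And>k. k \<notin> range Inl \<Longrightarrow> w' k = case_sum (\<lambda>_. 0) w k"
        unfolding Bex_def cell by blast
      have "w' (Inr i) = w i" for i using w'(3)[of "Inr i"] by auto
      then show ?l using w'(1,2) by (intro exI[of _ "w' \<circ> Inl"]) auto
    qed
    also have "\<dots> \<longleftrightarrow> case_sum (\<lambda>_. 0) w \<in> log_cell A' B' r' c' H'" by (rule *(4))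
    also have "\<dots> \<longleftrightarrow> w \<in> log_cell A (- A) r2 (c' \<circ> Inr) H2"
      unfolding log_cell_def A' B' H2_def r2_def by (auto simp: sum.reindex)
    finally show ?thesis .
  qed
  then have "{w. \<exists>t. (\<forall>j. t j < 0) \<and> (\<forall>i. w i = (\<Sum>j\<in>UNIV. M i j * t j))} =
      log_cell A (- A) r2 (c' \<circ> Inr) H2" by blast
  with rat2 show thesis using that by blast
qed

section \<open>Semialgebraic sets\<close>

lemma semialgebraic_Int: "semialgebraic S \<Longrightarrow> semialgebraic T \<Longrightarrow> semialgebraic (S \<inter> T)"
  using semialgebraic.intros(2)[OF semialgebraic.intros(3)[of "- S" "- T"]]
  by (simp add: semialgebraic.intros(2))

lemma semialgebraic_empty: "semialgebraic {}"
  using semialgebraic.intros(1)[OF real_polynomial_function.intros(2)[of 0]] by simp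

lemma semialgebraic_UNIV: "semialgebraic UNIV"
  using semialgebraic.intros(2)[OF semialgebraic_empty] by simp

lemma semialgebraic_Ball:
  assumes "finite I" "\<And>i. i \<in> I \<Longrightarrow> semialgebraic {x. P i x}"
  shows "semialgebraic {x. \<forall>i\<in>I. P i x}"
  using assms
proof (induction I rule: finite_induct)
  case (insert i I)
  have "{x. \<forall>i\<in>insert i I. P i x} = {x. P i x} \<inter> {x. \<forall>i\<in>I. P i x}" by auto
  then show ?case using insert by (simp add: semialgebraic_Int)
qed (simp add: semialgebraic_UNIV)

lemma semialgebraic_less:
  assumes "real_polynomial_function p" "real_polynomial_function q"
  shows "semialgebraic {x. p x < q x}"
  using semialgebraic.intros(1)[OF real_polynomial_function_diff[OF assms(2,1)]] by simp

lemma semialgebraic_eq: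
  assumes "real_polynomial_function p" "real_polynomial_function q"
  shows "semialgebraic {x. p x = q x}"
proof -
  have "{x. p x = q x} = - {x. p x < q x} \<inter> - {x. q x < p x}" by auto
  then show ?thesis
    using assms by (simp add: semialgebraic_Int semialgebraic.intros(2) semialgebraic_less)
qed

text \<open>Applied to \<open>fst\<close>, this carries a condition on the domain over to the
  product space in which the graph of a real function lies.\<close>

lemma semialgebraic_vimage_bounded_linear:
  assumes "semialgebraic S" "bounded_linear h"
  shows "semialgebraic (h -` S)"
  using assms(1)
proof induction
  case (1 p)
  have "real_polynomial_function (p \<circ> h)"
    using 1 assms(2) by (intro real_polynomial_function_compose polynomial_function_bounded_linear)
  then show ?case using semialgebraic.intros(1)[of "p \<circ> h"] by (simp add: vimage_def)
qed (auto simp: vimage_Compl intro: semialgebraic.intros(2,3))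

section \<open>Logarithmic conditions with rational coefficients\<close>

lemma finite_Rats_common_denominator:
  fixes r :: "'i \<Rightarrow> real"
  assumes "finite I" "\<And>i. i \<in> I \<Longrightarrow> r i \<in> \<rat>"
  obtains N :: nat where "N > 0" "\<And>i. i \<in> I \<Longrightarrow> real N * r i \<in> \<int>"
proof -
  have "\<exists>N::nat. N > 0 \<and> (\<forall>i\<in>I. real N * r i \<in> \<int>)"
    using assms
  proof (induction I rule: finite_induct)
    case (insert i I)
    then obtain N :: nat where N: "N > 0" "\<forall>i\<in>I. real N * r i \<in> \<int>" by auto
    obtain p :: int and q :: nat where q: "q > 0" "r i = of_int p / real q"
      using insert.prems[of i] unfolding Rats_eq_int_div_nat by blast
    have "real (N * q) * r k \<in> \<int>" if "k \<in> I" for k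
    proof -
      have "real (N * q) * r k = real q * (real N * r k)" by simp
      then show ?thesis using N(2) that by (metis Ints_mult Ints_of_nat)
    qed
    moreover have "real (N * q) * r i = of_int (int N * p)" using q by simp
    then have "real (N * q) * r i \<in> \<int>" by (metis Ints_of_int)
    ultimately show ?case using N(1) q(1) by (intro exI[of _ "N * q"]) auto
  qed auto
  then show thesis using that by blast
qed

text \<open>Multiplying by a common denominator \<open>N\<close>, moving negative exponents to the
  other side and exponentiating gives an inequality between two products of powers of the
  \<open>p i\<close>. The real bound \<open>e\<close> survives as the coefficient
  \<open>exp (real N * e)\<close>.\<close>

lemma semialgebraic_log_less:
  fixes p :: "'i \<Rightarrow> 'a::euclidean_space \<Rightarrow> real"
  assumes I: "finite I" and p: "\<And>i. i \<in> I \<Longrightarrow> real_polynomial_function (p i)"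
    and r: "\<And>i. i \<in> I \<Longrightarrow> r i \<in> \<rat>"
  shows "semialgebraic {z. (\<forall>i\<in>I. p i z > 0) \<and> (\<Sum>i\<in>I. r i * ln (p i z)) < e}"
proof -
  obtain N :: nat where N: "N > 0" "\<And>i. i \<in> I \<Longrightarrow> real N * r i \<in> \<int>"
    using finite_Rats_common_denominator[of I r] I r by metis
  \<comment> \<open>The floor is exact, since \<open>real N * r i\<close> is an integer;
    \<open>nat (n i)\<close> and \<open>nat (- n i)\<close> are its positive and negative
    parts.\<close>
  define n where "n i = \<lfloor>real N * r i\<rfloor>" for i
  have n: "real N * r i = real (nat (n i)) - real (nat (- n i))" if "i \<in> I" for i
    using N(2)[OF that] unfolding n_def by (auto elim!: Ints_cases)
  define F where "F m z = (\<Prod>i\<in>I. p i z ^ m i)" for m :: "'i \<Rightarrow> nat" and z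
  have F: "real_polynomial_function (F m)" for m
    unfolding F_def using I p by (intro real_polynomial_function_prod real_polynomial_function_power) auto
  have lnF: "F m z > 0 \<and> ln (F m z) = (\<Sum>i\<in>I. real (m i) * ln (p i z))" if "\<forall>i\<in>I. p i z > 0" for m z
  proof -
    have "ln (F m z) = (\<Sum>i\<in>I. ln (p i z ^ m i))"
      unfolding F_def using that I by (intro ln_prod) auto
    also have "\<dots> = (\<Sum>i\<in>I. real (m i) * ln (p i z))"
      using that by (intro sum.cong) (auto simp: ln_realpow)
    finally show ?thesis using that by (auto simp: F_def intro: prod_pos)
  qed
  have "(\<Sum>i\<in>I. r i * ln (p i z)) < e \<longleftrightarrow>
      F (\<lambda>i. nat (n i)) z < exp (real N * e) * F (\<lambda>i. nat (- n i)) z"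
    if pos: "\<forall>i\<in>I. p i z > 0" for z
  proof -
    let ?P = "F (\<lambda>i. nat (n i)) z" and ?Q = "F (\<lambda>i. nat (- n i)) z"
    have PQ: "?P > 0" "?Q > 0" using lnF[OF pos] by auto
    have "(\<Sum>i\<in>I. r i * ln (p i z)) < e \<longleftrightarrow> real N * (\<Sum>i\<in>I. r i * ln (p i z)) < real N * e"
      using N(1) by simp
    also have "real N * (\<Sum>i\<in>I. r i * ln (p i z)) = (\<Sum>i\<in>I. (real N * r i) * ln (p i z))"
      by (simp add: sum_distrib_left algebra_simps)
    also have "\<dots> = (\<Sum>i\<in>I. real (nat (n i)) * ln (p i z) - real (nat (- n i)) * ln (p i z))"
      by (intro sum.cong) (auto simp: n left_diff_distrib)
    also have "\<dots> = ln ?P - ln ?Q" using lnF[OF pos] by (simp add: sum_subtractf)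
    also have "ln ?P - ln ?Q < real N * e \<longleftrightarrow> ln ?P < ln (exp (real N * e) * ?Q)"
      using PQ by (auto simp: ln_mult)
    also have "\<dots> \<longleftrightarrow> ?P < exp (real N * e) * ?Q"
      using PQ by (intro ln_less_cancel_iff) auto
    finally show ?thesis .
  qed
  then have "{z. (\<forall>i\<in>I. p i z > 0) \<and> (\<Sum>i\<in>I. r i * ln (p i z)) < e} =
      {z. \<forall>i\<in>I. p i z > 0} \<inter> {z. F (\<lambda>i. nat (n i)) z < exp (real N * e) * F (\<lambda>i. nat (- n i)) z}"
    by auto
  also have "semialgebraic \<dots>"
    using I p F by (intro semialgebraic_Int semialgebraic_Ball semialgebraic.intros(1)
      semialgebraic_less real_polynomial_function.intros(4) real_polynomial_function.intros(2)) auto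
  finally show ?thesis .
qed

lemma semialgebraic_log_eq:
  fixes p :: "'i \<Rightarrow> 'a::euclidean_space \<Rightarrow> real"
  assumes I: "finite I" and p: "\<And>i. i \<in> I \<Longrightarrow> real_polynomial_function (p i)"
    and r: "\<And>i. i \<in> I \<Longrightarrow> r i \<in> \<rat>"
  shows "semialgebraic {z. (\<forall>i\<in>I. p i z > 0) \<and> (\<Sum>i\<in>I. r i * ln (p i z)) = e}"
proof -
  have "{z. (\<forall>i\<in>I. p i z > 0) \<and> (\<Sum>i\<in>I. r i * ln (p i z)) = e} = {z. \<forall>i\<in>I. p i z > 0} \<inter>
     (- {z. (\<forall>i\<in>I. p i z > 0) \<and> (\<Sum>i\<in>I. r i * ln (p i z)) < e} \<inter>
      - {z. (\<forall>i\<in>I. p i z > 0) \<and> (\<Sum>i\<in>I. (- r i) * ln (p i z)) < - e})"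
    by (auto simp: sum_negf)
  also have "semialgebraic \<dots>"
    using assms by (intro semialgebraic_Int semialgebraic.intros(2) semialgebraic_log_less
        semialgebraic_Ball semialgebraic.intros(1)) auto
  finally show ?thesis .
qed

section \<open>Exponentials of polyhedral graphs\<close>

text \<open>Positivity keeps \<open>ln\<close> within its meaningful range. Coordinates outside
  \<open>A \<union> B\<close> vanish by the convention for coordinate subspaces, and
  \<open>log_cell A B\<close> does not read them.\<close>

definition exp_cell ::
    "'n::finite set \<Rightarrow> 'n set \<Rightarrow> ('n \<Rightarrow> 'n \<Rightarrow> real) \<Rightarrow> ('n \<Rightarrow> real) \<Rightarrow> (('n \<Rightarrow> real) \<times> real) set \<Rightarrow>
     (real^'n) set" where
  "exp_cell A B r c H =
     {z \<in> coord_space (A \<union> B). (\<forall>k\<in>A \<union> B. 0 < z $ k) \<and> (\<lambda>k. ln (z $ k)) \<in> log_cell A B r c H}"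

text \<open>With no dependent coordinates the domain is itself an \<open>exp_cell\<close>, so
  \<open>semialgebraic_exp_cell\<close> covers domains as well as graphs.\<close>

abbreviation monomial_domain :: "'n::finite set \<Rightarrow> (('n \<Rightarrow> real) \<times> real) set \<Rightarrow> (real^'n) set" where
  "monomial_domain A H \<equiv> exp_cell A {} (\<lambda>_ _. 0) (\<lambda>_. 0) H"

definition monomial_map ::
    "'n::finite set \<Rightarrow> 'n set \<Rightarrow> ('n \<Rightarrow> 'n \<Rightarrow> real) \<Rightarrow> ('n \<Rightarrow> real) \<Rightarrow> real^'n \<Rightarrow> real^'n" where
  "monomial_map A B r c x = (\<chi> i. if i \<in> B then exp (c i + (\<Sum>k\<in>A. r i k * ln (x $ k))) else 0)"

lemma mem_monomial_domain:
  "x \<in> monomial_domain A H \<longleftrightarrow> x \<in> coord_space A \<and> (\<forall>k\<in>A. 0 < x $ k) \<and>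
     (\<forall>(m, e)\<in>H. (\<Sum>k\<in>A. m k * ln (x $ k)) < e)"
  by (auto simp: exp_cell_def log_cell_def)

lemma semialgebraic_exp_cell:
  assumes disj: "A \<inter> B = {}" and rat: "rational_data r H"
  shows "semialgebraic (exp_cell A B r c H)"
proof -
  have lin: "real_polynomial_function (\<lambda>z::real^'a. z $ k)" for k
    by (intro real_polynomial_function.intros(1) bounded_linear_vec_nth)
  have coord: "semialgebraic (coord_space D :: (real^'a) set)" for D
  proof -
    have "coord_space D = {z::real^'a. \<forall>k\<in>- D. z $ k = 0}" by (auto simp: coord_space_def)
    then show ?thesis using lin by (auto intro!: semialgebraic_Ball semialgebraic_eq)
  qed
  \<comment> \<open>\<open>R i\<close> collects all logarithms on one side, which brings the
    equation of \<open>i\<close> into the form of \<open>semialgebraic_log_eq\<close>.\<close>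
  define R where "R i k = (if k = i then 1 else - r i k)" for i k
  have "(\<Sum>k\<in>A. r i k * ln (z $ k)) = ln (z $ i) - (\<Sum>k\<in>insert i A. R i k * ln (z $ k))"
    if "i \<in> B" for i and z :: "real^'a"
  proof -
    have "i \<notin> A" using that disj by auto
    moreover have "(\<Sum>k\<in>A. R i k * ln (z $ k)) = (\<Sum>k\<in>A. - (r i k * ln (z $ k)))"
      using calculation by (intro sum.cong) (auto simp: R_def)
    ultimately show ?thesis by (simp add: sum_negf) (simp add: R_def)
  qed
  then have "exp_cell A B r c H = coord_space (A \<union> B) \<inter> ({z. \<forall>k\<in>A \<union> B. 0 < z $ k} \<inter>
     ({z. \<forall>i\<in>B. (\<forall>k\<in>insert i A. 0 < z $ k) \<and> (\<Sum>k\<in>insert i A. R i k * ln (z $ k)) = c i} \<inter>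
      {z. \<forall>h\<in>H. (\<forall>k\<in>A. 0 < z $ k) \<and> (\<Sum>k\<in>A. fst h k * ln (z $ k)) < snd h}))"
    unfolding exp_cell_def log_cell_def by (fastforce simp del: sum.insert)
  also have "semialgebraic \<dots>"
    using rat lin unfolding rational_data_def R_def
    by (intro semialgebraic_Int coord semialgebraic_Ball semialgebraic_log_eq semialgebraic_log_less
        semialgebraic.intros(1)) auto
  finally show ?thesis .
qed

text \<open>Elimination and slicing act on cells, while monotonicity speaks of a domain and a map;
  this identity translates between the two.\<close>

lemma map_graph_monomial_map:
  assumes "A \<inter> B = {}"
  shows "map_graph (monomial_domain A H) (monomial_map A B r c) = exp_cell A B r c H"
proof (intro equalityI subsetI)
  fix z assume "z \<in> map_graph (monomial_domain A H) (monomial_map A B r c)"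
  then obtain x where x: "x \<in> monomial_domain A H" and z: "z = x + monomial_map A B r c x"
    unfolding map_graph_def by auto
  have zA: "z $ k = x $ k" if "k \<in> A" for k
    using that assms by (auto simp: z monomial_map_def)
  have s: "(\<Sum>k\<in>A. m k * ln (z $ k)) = (\<Sum>k\<in>A. m k * ln (x $ k))" for m
    by (intro sum.cong) (auto simp: zA)
  have zB: "z $ i = exp (c i + (\<Sum>k\<in>A. r i k * ln (z $ k)))" if "i \<in> B" for i
    using that assms x unfolding s by (auto simp: z monomial_map_def mem_monomial_domain coord_space_def)
  have "z $ i = 0" if "i \<notin> A \<union> B" for i
    using that x by (auto simp: z monomial_map_def mem_monomial_domain coord_space_def)
  moreover note s
  moreover have "ln (z $ i) = c i + (\<Sum>k\<in>A. r i k * ln (z $ k))" if "i \<in> B" for i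
    using zB[OF that] by (metis ln_exp)
  moreover have "z $ i > 0" if "i \<in> B" for i using zB[OF that] by (metis exp_gt_zero)
  ultimately show "z \<in> exp_cell A B r c H"
    using x zA unfolding exp_cell_def log_cell_def by (auto simp: coord_space_def)
next
  fix z assume z: "z \<in> exp_cell A B r c H"
  define x where "x = (\<chi> k. if k \<in> A then z $ k else 0)"
  have s: "(\<Sum>k\<in>A. m k * ln (x $ k)) = (\<Sum>k\<in>A. m k * ln (z $ k))" for m
    by (intro sum.cong) (auto simp: x_def)
  have "x \<in> monomial_domain A H"
    unfolding mem_monomial_domain s using z
    by (auto simp: x_def exp_cell_def log_cell_def coord_space_def)
  moreover have "z $ k = (x + monomial_map A B r c x) $ k" for k
  proof (cases "k \<in> B")
    case True
    then have "exp (ln (z $ k)) = exp (c k + (\<Sum>j\<in>A. r k j * ln (z $ j)))" "z $ k > 0"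
      using z by (auto simp: exp_cell_def log_cell_def)
    moreover have "k \<notin> A" using True assms by auto
    ultimately show ?thesis using True by (simp add: monomial_map_def s) (simp add: x_def)
  next
    case False
    then show ?thesis using z by (auto simp: monomial_map_def x_def exp_cell_def coord_space_def)
  qed
  then have "z = x + monomial_map A B r c x" by (simp add: vec_eq_iff)
  ultimately show "z \<in> map_graph (monomial_domain A H) (monomial_map A B r c)"
    unfolding map_graph_def by blast
qed

section \<open>Monomial domains as semi-monotone sets\<close>

lemma openin_monomial_domain:
  assumes "finite H"
  shows "openin (top_of_set (coord_space A)) (monomial_domain A H)"
proof -
  let ?U = "{x::real^'a. \<forall>k\<in>A. 0 < x $ k}"
  have U: "open ?U"
  proof -
    have "?U = (\<Inter>k\<in>A. {x. 0 < x $ k})" by auto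
    then show ?thesis by (auto intro!: open_INT open_Collect_less continuous_intros)
  qed
  \<comment> \<open>Each half-space is pulled back inside \<open>?U\<close>, where the logarithms
    are continuous.\<close>
  have "open (?U \<inter> (\<lambda>x. \<Sum>k\<in>A. m k * ln (x $ k)) -` {..<e})" for m e
    by (intro continuous_open_preimage U open_lessThan continuous_intros) force
  then have "open (?U \<inter> (\<Inter>(m, e)\<in>H. ?U \<inter> (\<lambda>x. \<Sum>k\<in>A. m k * ln (x $ k)) -` {..<e}))"
    using U assms by (intro open_Int open_INT) auto
  moreover have "monomial_domain A H =
      coord_space A \<inter> (?U \<inter> (\<Inter>(m, e)\<in>H. ?U \<inter> (\<lambda>x. \<Sum>k\<in>A. m k * ln (x $ k)) -` {..<e}))"
    by (auto simp: mem_monomial_domain)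
  ultimately show ?thesis by (auto simp: openin_open)
qed

lemma connected_monomial_domain_cone:
  assumes K: "coordinate_cone A K"
  shows "connected (monomial_domain A H \<inter> K)"
proof -
  obtain J \<sigma> c where J: "J \<subseteq> A" and \<sigma>: "\<forall>j\<in>J. \<sigma> j \<in> {(<), (=), (>)}"
    and K: "K = {z \<in> coord_space A. \<forall>j\<in>J. \<sigma> j (z $ j) (c j :: real)}"
    using K unfolding coordinate_cone_def by blast
  define E :: "real^'a \<Rightarrow> real^'a" where "E u = (\<chi> k. if k \<in> A then exp (u $ k) else 0)" for u
  define P :: "(real^'a) set" where
    "P = (\<Inter>(m, e)\<in>H. (\<lambda>u. \<Sum>k\<in>A. m k * u $ k) -` {..<e}) \<inter>
      (\<Inter>j\<in>J. (\<lambda>u. u $ j) -` {s. \<sigma> j (exp s) (c j)})"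
  \<comment> \<open>Monotonicity of \<open>exp\<close> already yields an interval; passing to
    \<open>ln (c j)\<close> instead would force a case split on the sign of
    \<open>c j\<close>.\<close>
  have "convex {s. \<sigma> j (exp s) (c j)}" if "j \<in> J" for j
  proof -
    have "is_interval {s. \<sigma> j (exp s) (c j)}"
      unfolding is_interval_1
    proof (intro ballI allI impI)
      fix x y z assume x: "x \<in> {s. \<sigma> j (exp s) (c j)}" and y: "y \<in> {s. \<sigma> j (exp s) (c j)}"
        and "x \<le> z \<and> z \<le> y"
      then have "exp x \<le> exp z" "exp z \<le> exp y" by simp_all
      moreover have "\<sigma> j = (<) \<or> \<sigma> j = (=) \<or> \<sigma> j = (>)" using \<sigma> that by blast
      ultimately show "z \<in> {s. \<sigma> j (exp s) (c j)}" using x y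
        by (elim disjE; simp only: mem_Collect_eq; linarith)
    qed
    then show ?thesis by (simp add: is_interval_convex_1)
  qed
  then have "convex ((\<lambda>u::real^'a. u $ j) -` {s. \<sigma> j (exp s) (c j)})" if "j \<in> J" for j
    using that by (intro convex_linear_vimage) (auto simp: linear_iff)
  moreover have "linear (\<lambda>u::real^'a. \<Sum>k\<in>A. m k * u $ k)" for m
    by (intro linear_compose_sum) (auto simp: linear_iff algebra_simps)
  then have "convex ((\<lambda>u::real^'a. \<Sum>k\<in>A. m k * u $ k) -` {..<e})" for m e
    by (intro convex_linear_vimage) auto
  ultimately have "convex P"
    unfolding P_def by (intro convex_Int convex_INT) (simp_all only: case_prod_unfold)
  moreover have "continuous_on P (\<lambda>u. if k \<in> A then exp (u $ k) else 0)" for k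
    by (cases "k \<in> A") (auto intro!: continuous_intros)
  then have "continuous_on P E" unfolding E_def by (rule continuous_on_vec_lambda)
  ultimately have "connected (E ` P)"
    by (intro connected_continuous_image convex_connected)
  moreover have "E ` P = monomial_domain A H \<inter> K"
  proof (intro equalityI subsetI)
    fix z assume "z \<in> E ` P"
    then obtain u where u: "u \<in> P" and z: "z = E u" by auto
    have "(\<Sum>k\<in>A. m k * ln (z $ k)) = (\<Sum>k\<in>A. m k * u $ k)" for m
      by (intro sum.cong) (auto simp: z E_def)
    then show "z \<in> monomial_domain A H \<inter> K"
      using u J unfolding P_def K by (auto simp: mem_monomial_domain z E_def coord_space_def)
  next
    fix z assume z: "z \<in> monomial_domain A H \<inter> K"
    define u :: "real^'a" where "u = (\<chi> k. ln (z $ k))"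
    have "z = E u"
      using z by (auto simp: mem_monomial_domain E_def u_def vec_eq_iff coord_space_def)
    moreover have "u \<in> P"
      using z J by (auto simp: mem_monomial_domain P_def u_def K)
    ultimately show "z \<in> E ` P" by blast
  qed
  ultimately show ?thesis by simp
qed

lemma semi_monotone_monomial_domain:
  assumes "bounded (monomial_domain A H)" "finite H" "\<forall>(m, e)\<in>H. \<forall>k. m k \<in> \<rat>"
  shows "semi_monotone A (monomial_domain A H)"
  unfolding semi_monotone_def
  using assms by (intro conjI openin_monomial_domain semialgebraic_exp_cell allI impI
      connected_monomial_domain_cone) (auto simp: rational_data_def)

section \<open>Boundedness, admissibility and monotone components\<close>

lemma bounded_vec_componentwise:
  fixes S :: "(real^'n::finite) set"
  assumes "\<And>x k. x \<in> S \<Longrightarrow> \<bar>x $ k\<bar> \<le> K"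
  shows "bounded S"
proof -
  have "norm x \<le> (\<Sum>k\<in>(UNIV :: 'n set). K)" if "x \<in> S" for x
    by (rule order.trans[OF norm_le_l1_cart sum_mono]) (rule assms[OF that])
  then show ?thesis unfolding bounded_iff by blast
qed

text \<open>Upper bounds on the logarithms are enough: a logarithm tending to minus infinity only
  brings a positive coordinate close to 0.\<close>

lemma bounded_exp_cell:
  assumes "\<And>w k. w \<in> log_cell A B r c H \<Longrightarrow> k \<in> A \<union> B \<Longrightarrow> w k \<le> K"
  shows "bounded (exp_cell A B r c H)"
proof (rule bounded_vec_componentwise)
  fix z k assume z: "z \<in> exp_cell A B r c H"
  show "\<bar>z $ k\<bar> \<le> exp K"
  proof (cases "k \<in> A \<union> B")
    case True
    then have "z $ k > 0" "ln (z $ k) \<le> K"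
      using z assms[of "\<lambda>k. ln (z $ k)" k] by (auto simp: exp_cell_def)
    then show ?thesis by (metis abs_of_pos exp_le_cancel_iff exp_ln)
  next
    case False
    then show ?thesis using z by (auto simp: exp_cell_def coord_space_def)
  qed
qed

lemma exp_cell_bounded_factors:
  assumes disj: "A \<inter> B = {}" and bdd: "bounded (exp_cell A B r c H)"
  shows "bounded (monomial_domain A H)" "bounded (monomial_map A B r c ` monomial_domain A H)"
proof -
  obtain K where K: "\<And>z. z \<in> exp_cell A B r c H \<Longrightarrow> norm z \<le> K"
    using bdd unfolding bounded_iff by blast
  have c: "\<bar>x $ k\<bar> \<le> K \<and> \<bar>monomial_map A B r c x $ k\<bar> \<le> K" if x: "x \<in> monomial_domain A H" for x k
  proof -
    have "x + monomial_map A B r c x \<in> exp_cell A B r c H"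
      unfolding map_graph_monomial_map[OF disj, symmetric] map_graph_def using x by blast
    then have "\<bar>(x + monomial_map A B r c x) $ k\<bar> \<le> K"
      using K component_le_norm_cart order.trans by blast
    \<comment> \<open>The supports of \<open>x\<close> and of its image are disjoint, so each
      coordinate of the sum comes from one of them alone.\<close>
    moreover have "x $ k = 0 \<or> monomial_map A B r c x $ k = 0"
      using disj x by (auto simp: mem_monomial_domain coord_space_def monomial_map_def)
    ultimately show ?thesis by auto
  qed
  show "bounded (monomial_domain A H)" "bounded (monomial_map A B r c ` monomial_domain A H)"
    by (rule bounded_vec_componentwise[of _ K]; use c in blast)+
qed

lemma continuous_on_monomial_map: "continuous_on (monomial_domain A H) (monomial_map A B r c)"
proof -
  have "continuous_on (monomial_domain A H)
      (\<lambda>x. if i \<in> B then exp (c i + (\<Sum>k\<in>A. r i k * ln (x $ k))) else 0)" for i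
    by (cases "i \<in> B") (auto intro!: continuous_intros simp: mem_monomial_domain, metis less_irrefl)
  then show ?thesis
    unfolding monomial_map_def by (intro continuous_on_vec_lambda)
qed

lemma admissible_monomial_map:
  assumes disj: "A \<inter> B = {}" and bdd: "bounded (exp_cell A B r c H)"
    and ne: "exp_cell A B r c H \<noteq> {}" and rat: "rational_data r H"
  shows "admissible_map A B (monomial_domain A H) (monomial_map A B r c)"
proof -
  have "monomial_domain A H \<noteq> {}"
    using ne unfolding map_graph_monomial_map[OF disj, symmetric] map_graph_def by blast
  moreover have "semi_monotone A (monomial_domain A H)"
    using exp_cell_bounded_factors(1)[OF disj bdd] rat
    by (intro semi_monotone_monomial_domain) (auto simp: rational_data_def)
  moreover have "monomial_map A B r c ` monomial_domain A H \<subseteq> coord_space B"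
    by (auto simp: coord_space_def monomial_map_def)
  ultimately show ?thesis
    unfolding admissible_map_def map_graph_monomial_map[OF disj]
    using disj exp_cell_bounded_factors(2)[OF disj bdd] semialgebraic_exp_cell[OF disj rat]
      continuous_on_monomial_map by blast
qed

lemma semi_monotone_empty: "semi_monotone A {}"
  by (simp add: semi_monotone_def semialgebraic_empty)

text \<open>The logarithm of a component is affine in the logarithms of the coordinates. Hence a
  level condition adds one half-space to \<open>H\<close>, and the sign of \<open>r i j\<close>
  decides the behaviour in the \<open>j\<close>-th coordinate.\<close>

lemma monotone_function_monomial_map:
  assumes disj: "A \<inter> B = {}" and bdd: "bounded (exp_cell A B r c H)"
    and ne: "exp_cell A B r c H \<noteq> {}" and rat: "rational_data r H" and i: "i \<in> B"
  shows "monotone_function A (monomial_domain A H) (\<lambda>x. monomial_map A B r c x $ i)"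
proof -
  let ?X = "monomial_domain A H"
  let ?f = "\<lambda>x::real^'a. exp (c i + (\<Sum>k\<in>A. r i k * ln (x $ k)))"
  have f: "(\<lambda>x. monomial_map A B r c x $ i) = ?f"
    using i by (simp add: monomial_map_def)
  note adm = admissible_monomial_map[OF disj bdd ne rat]
  have H: "finite H" "\<forall>(m, e)\<in>H. \<forall>k. m k \<in> \<rat>" and r: "\<forall>i k. r i k \<in> \<rat>"
    using rat by (auto simp: rational_data_def)
  have X: "bounded ?X" and semX: "semi_monotone A ?X" "?X \<noteq> {}"
    using adm exp_cell_bounded_factors(1)[OF disj bdd] by (auto simp: admissible_map_def)
  have sub: "semi_monotone A (monomial_domain A (insert (m, e) H))" if "\<And>k. m k \<in> \<rat>" for m e
  proof (rule semi_monotone_monomial_domain)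
    show "bounded (monomial_domain A (insert (m, e) H))"
      by (rule bounded_subset[OF X]) (auto simp: mem_monomial_domain)
  qed (use H that in auto)
  have ins: "x \<in> monomial_domain A (insert (m, e) H) \<longleftrightarrow>
      x \<in> ?X \<and> (\<Sum>k\<in>A. m k * ln (x $ k)) < e" for x m e
    by (auto simp: mem_monomial_domain)
  \<comment> \<open>Positive levels become half-spaces through \<open>ln b\<close>. At other levels
    the sublevel set is empty and the superlevel set is the whole domain, since the component is
    positive.\<close>
  have less: "semi_monotone A {x\<in>?X. ?f x < b}" for b
  proof (cases "b > 0")
    case True
    then have "?f x < b \<longleftrightarrow> c i + (\<Sum>k\<in>A. r i k * ln (x $ k)) < ln b" for x
      by (metis exp_less_cancel_iff exp_ln)
    then have "?f x < b \<longleftrightarrow> (\<Sum>k\<in>A. r i k * ln (x $ k)) < ln b - c i" for x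
      by (simp add: less_diff_eq add.commute)
    then have "{x\<in>?X. ?f x < b} = monomial_domain A (insert (r i, ln b - c i) H)"
      by (simp only: ins set_eq_iff mem_Collect_eq simp_thms)
    then show ?thesis using sub r by simp
  next
    case False
    then have "\<not> exp v < b" for v using exp_gt_zero[of v] by linarith
    then have "{x\<in>?X. ?f x < b} = {}" by blast
    then show ?thesis by (simp only: semi_monotone_empty)
  qed
  have gr: "semi_monotone A {x\<in>?X. ?f x > b}" for b
  proof (cases "b > 0")
    case True
    then have "?f x > b \<longleftrightarrow> ln b < c i + (\<Sum>k\<in>A. r i k * ln (x $ k))" for x
      by (metis exp_less_cancel_iff exp_ln)
    then have "?f x > b \<longleftrightarrow> (\<Sum>k\<in>A. - r i k * ln (x $ k)) < c i - ln b" for x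
      by (simp add: sum_negf less_diff_eq diff_less_eq add.commute)
    then have "{x\<in>?X. ?f x > b} = monomial_domain A (insert (\<lambda>k. - r i k, c i - ln b) H)"
      by (simp only: ins set_eq_iff mem_Collect_eq simp_thms)
    then show ?thesis using sub[of "\<lambda>k. - r i k"] r by simp
  next
    case False
    then have "exp v > b" for v using exp_gt_zero[of v] by linarith
    then have "{x\<in>?X. ?f x > b} = ?X" by blast
    then show ?thesis using semX by simp
  qed
  have cont: "continuous_on ?X ?f" "bounded (?f ` ?X)"
  proof -
    show "continuous_on ?X ?f"
      unfolding f[symmetric]
      by (intro bounded_linear.continuous_on[OF bounded_linear_vec_nth] continuous_on_monomial_map)
    have "bounded ((\<lambda>v. v $ i) ` monomial_map A B r c ` ?X)"
      by (rule bounded_linear_image[OF exp_cell_bounded_factors(2)[OF disj bdd] bounded_linear_vec_nth])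
    then show "bounded (?f ` ?X)" by (simp only: image_image f)
  qed
  have graph: "semialgebraic ((\<lambda>x. (x, ?f x)) ` ?X)"
  proof -
    \<comment> \<open>\<open>None\<close> indexes the value and \<open>Some k\<close> the coordinate
      \<open>k\<close> of the argument, which puts the equation of the graph into the form of
      \<open>semialgebraic_log_eq\<close>.\<close>
    define p :: "'a option \<Rightarrow> (real^'a) \<times> real \<Rightarrow> real" where
      "p k z = (case k of None \<Rightarrow> snd z | Some k \<Rightarrow> fst z $ k)" for k z
    define R where "R k = (case k of None \<Rightarrow> 1 | Some k \<Rightarrow> - r i k)" for k
    have p: "real_polynomial_function (p k)" for k
      unfolding p_def by (cases k) (auto intro!: real_polynomial_function.intros(1)
          bounded_linear_snd bounded_linear_compose[OF bounded_linear_vec_nth bounded_linear_fst])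
    have R: "R k \<in> \<rat>" for k using r by (auto simp: R_def split: option.split)
    have "y = ?f x \<longleftrightarrow> y > 0 \<and> ln y = c i + (\<Sum>k\<in>A. r i k * ln (x $ k))" for x and y :: real
      by (metis exp_gt_zero exp_ln ln_exp)
    then have "(\<lambda>x. (x, ?f x)) ` ?X = fst -` ?X \<inter>
        {z. (\<forall>k\<in>insert None (Some ` A). p k z > 0) \<and>
          (\<Sum>k\<in>insert None (Some ` A). R k * ln (p k z)) = c i}"
      by (auto simp: p_def R_def sum.reindex mem_monomial_domain image_iff sum_negf)
    also have "semialgebraic \<dots>"
      using rat p R by (intro semialgebraic_Int semialgebraic_vimage_bounded_linear
        bounded_linear_fst semialgebraic_log_eq semialgebraic_exp_cell) (auto simp: rational_data_def)
    finally show ?thesis .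
  qed
  have mono: "strictly_increasing_in ?X ?f j \<or> strictly_decreasing_in ?X ?f j \<or> independent_of ?X ?f j"
    if j: "j \<in> A" for j
  proof -
    have "(\<Sum>k\<in>A. r i k * ln (y $ k)) - (\<Sum>k\<in>A. r i k * ln (x $ k)) = r i j * (ln (y $ j) - ln (x $ j))"
      if "differ_only_at j x y" for x y
    proof -
      have "(\<Sum>k\<in>A - {j}. r i k * ln (y $ k)) = (\<Sum>k\<in>A - {j}. r i k * ln (x $ k))"
        using that by (intro sum.cong) (auto simp: differ_only_at_def)
      then show ?thesis using j by (simp add: sum.remove right_diff_distrib)
    qed
    note d = this
    have lt: "ln (x $ j) < ln (y $ j)" if "x \<in> ?X" "y \<in> ?X" "x $ j < y $ j" for x y
      using that j by (auto simp: mem_monomial_domain)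
    consider "r i j > 0" | "r i j < 0" | "r i j = 0" by linarith
    then show ?thesis
    proof cases
      case 1
      have "?f x < ?f y" if "x \<in> ?X" "y \<in> ?X" "differ_only_at j x y" "x $ j < y $ j" for x y
        using d[OF that(3)] mult_pos_pos[OF 1, of "ln (y $ j) - ln (x $ j)"] lt[OF that(1,2,4)] by simp
      then show ?thesis by (auto simp: strictly_increasing_in_def)
    next
      case 2
      have "?f x > ?f y" if "x \<in> ?X" "y \<in> ?X" "differ_only_at j x y" "x $ j < y $ j" for x y
        using d[OF that(3)] mult_neg_pos[OF 2, of "ln (y $ j) - ln (x $ j)"] lt[OF that(1,2,4)] by simp
      then show ?thesis by (auto simp: strictly_decreasing_in_def)
    next
      case 3
      then show ?thesis using d by (fastforce simp: independent_of_def)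
    qed
  qed
  show ?thesis
    unfolding monotone_function_def f using semX cont graph less gr mono by blast
qed

text \<open>Read contrapositively, genuine dependence on \<open>j\<close> supplies the nonzero pivot
  entry \<open>r i j\<close> that slicing requires.\<close>

lemma independent_of_monomial_map:
  assumes "i \<in> B" "r i j = 0"
  shows "independent_of X (\<lambda>x. monomial_map A B r c x $ i) j"
proof -
  have "(\<Sum>k\<in>A. r i k * ln (x $ k)) = (\<Sum>k\<in>A. r i k * ln (y $ k))" if "differ_only_at j x y" for x y
    using that assms by (intro sum.cong) (auto simp: differ_only_at_def)
  then show ?thesis using assms by (auto simp: independent_of_def monomial_map_def)
qed

section \<open>Basis sets and slices\<close>

text \<open>The row of coordinate \<open>s\<close> in the linear part of the graph's parametrization
  in logarithms: an identity block on \<open>A\<close>, the slopes \<open>r\<close> elsewhere,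
  constants dropped.\<close>

definition linear_part :: "'k set \<Rightarrow> ('k \<Rightarrow> 'k \<Rightarrow> real) \<Rightarrow> 'k \<Rightarrow> ('k \<Rightarrow> real) \<Rightarrow> real" where
  "linear_part A r s u = (if s \<in> A then u s else \<Sum>k\<in>A. r s k * u k)"

lemma log_graph_coordinate:
  assumes "A \<inter> B = {}" "s \<in> A \<union> B" "x \<in> monomial_domain A H"
  shows "(x + monomial_map A B r c x) $ s > 0"
    and "ln ((x + monomial_map A B r c x) $ s) =
      (if s \<in> A then 0 else c s) + linear_part A r s (\<lambda>k. ln (x $ k))"
  using assms by (auto simp: mem_monomial_domain coord_space_def monomial_map_def linear_part_def)

text \<open>In logarithms the selected coordinates form an affine map on a non-empty open set, where
  injectivity is a matter of the kernel. The criterion mentions neither \<open>c\<close> nor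
  \<open>H\<close>, the only data that will vary with the level of a slice.\<close>

lemma inj_on_graph_coordinates_iff:
  assumes disj: "A \<inter> B = {}" and H: "finite H" and ne: "monomial_domain A H \<noteq> {}"
    and S: "S \<subseteq> A \<union> B"
  shows "inj_on (\<lambda>x. \<chi> s. if s \<in> S then (x + monomial_map A B r c x) $ s else 0) (monomial_domain A H) \<longleftrightarrow>
    (\<forall>u. (\<forall>s\<in>S. linear_part A r s u = 0) \<longrightarrow> (\<forall>k\<in>A. u k = 0))" (is "inj_on ?g ?X \<longleftrightarrow> ?R")
proof -
  have lin: "linear_part A r s (\<lambda>k. ln (x $ k)) = linear_part A r s (\<lambda>k. ln (y $ k)) \<longleftrightarrow>
      (x + monomial_map A B r c x) $ s = (y + monomial_map A B r c y) $ s"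
    if "s \<in> S" "x \<in> ?X" "y \<in> ?X" for s x y
  proof -
    have s: "s \<in> A \<union> B" using that S by auto
    show ?thesis
      using log_graph_coordinate[OF disj s that(2), of r c] log_graph_coordinate[OF disj s that(3), of r c]
      by (metis add_left_cancel ln_inj_iff)
  qed
  show ?thesis
  proof
    assume R: ?R
    show "inj_on ?g ?X"
    proof (rule inj_onI)
      fix x y assume x: "x \<in> ?X" and y: "y \<in> ?X" and eq: "?g x = ?g y"
      have "linear_part A r s (\<lambda>k. ln (x $ k) - ln (y $ k)) = 0" if "s \<in> S" for s
      proof -
        have "(x + monomial_map A B r c x) $ s = (y + monomial_map A B r c y) $ s"
          using eq that unfolding vec_eq_iff by (auto dest!: spec[of _ s])
        then have "linear_part A r s (\<lambda>k. ln (x $ k)) = linear_part A r s (\<lambda>k. ln (y $ k))"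
          using lin that x y by blast
        then show ?thesis by (auto simp: linear_part_def right_diff_distrib sum_subtractf)
      qed
      then have "\<forall>k\<in>A. ln (x $ k) - ln (y $ k) = 0" using R by blast
      then show "x = y"
        using x y by (auto simp: vec_eq_iff mem_monomial_domain coord_space_def)
    qed
  next
    assume inj: "inj_on ?g ?X"
    show ?R
    proof (intro allI impI)
      fix u assume u: "\<forall>s\<in>S. linear_part A r s u = 0"
      obtain x where x: "x \<in> ?X" using ne by blast
      \<comment> \<open>If \<open>u\<close> is in the kernel, moving \<open>ln x\<close> slightly along \<open>u\<close> stays in the open domain
        and keeps all coordinates in \<open>S\<close>.\<close>
      define y where "y \<epsilon> = (\<chi> k. if k \<in> A then x $ k * exp (\<epsilon> * u k) else 0)" for \<epsilon>
      have lny: "ln (y \<epsilon> $ k) = ln (x $ k) + \<epsilon> * u k" if "k \<in> A" for \<epsilon> k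
        using that x by (auto simp: y_def mem_monomial_domain ln_mult)
      have sum: "(\<Sum>k\<in>A. m k * ln (y \<epsilon> $ k)) = (\<Sum>k\<in>A. m k * ln (x $ k)) + \<epsilon> * (\<Sum>k\<in>A. m k * u k)"
        for m \<epsilon>
        by (simp add: lny algebra_simps sum.distrib sum_distrib_left)
      have "eventually (\<lambda>\<epsilon>. \<forall>(m, e)\<in>H. (\<Sum>k\<in>A. m k * ln (y \<epsilon> $ k)) < e) (at_right 0)"
        unfolding case_prod_unfold sum
      proof (rule eventually_ball_finite[OF H], intro ballI)
        fix h assume "h \<in> H"
        then have "(\<Sum>k\<in>A. fst h k * ln (x $ k)) + 0 * (\<Sum>k\<in>A. fst h k * u k) < snd h"
          using x by (auto simp: mem_monomial_domain case_prod_unfold)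
        moreover have "((\<lambda>\<epsilon>. (\<Sum>k\<in>A. fst h k * ln (x $ k)) + \<epsilon> * (\<Sum>k\<in>A. fst h k * u k)) \<longlongrightarrow>
            (\<Sum>k\<in>A. fst h k * ln (x $ k)) + 0 * (\<Sum>k\<in>A. fst h k * u k)) (at_right 0)"
          by (intro tendsto_intros)
        ultimately show "eventually (\<lambda>\<epsilon>. (\<Sum>k\<in>A. fst h k * ln (x $ k)) +
            \<epsilon> * (\<Sum>k\<in>A. fst h k * u k) < snd h) (at_right 0)"
          by (rule order_tendstoD(2)[rotated])
      qed
      \<comment> \<open>A nonzero \<open>\<epsilon>\<close> can be cancelled when
        \<open>y \<epsilon> = x\<close> is turned into \<open>u k = 0\<close>.\<close>
      moreover have "eventually (\<lambda>\<epsilon>::real. \<epsilon> > 0) (at_right 0)" by (rule eventually_at_right_less)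
      ultimately have "eventually (\<lambda>\<epsilon>. (\<forall>(m, e)\<in>H. (\<Sum>k\<in>A. m k * ln (y \<epsilon> $ k)) < e) \<and> \<epsilon> > 0) (at_right 0)"
        by (rule eventually_conj)
      then obtain \<epsilon> where \<epsilon>: "\<forall>(m, e)\<in>H. (\<Sum>k\<in>A. m k * ln (y \<epsilon> $ k)) < e" "\<epsilon> > 0"
        using eventually_happens'[OF trivial_limit_at_right_real] by blast
      have y: "y \<epsilon> \<in> ?X"
        using \<epsilon>(1) x unfolding mem_monomial_domain by (auto simp: y_def coord_space_def)
      have "linear_part A r s (\<lambda>k. ln (y \<epsilon> $ k)) = linear_part A r s (\<lambda>k. ln (x $ k)) + \<epsilon> * linear_part A r s u"
        for s
        by (cases "s \<in> A") (simp add: linear_part_def lny, simp only: linear_part_def if_False sum)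
      then have "?g (y \<epsilon>) = ?g x"
        using u lin[OF _ y x] by (auto simp: vec_eq_iff)
      then have "y \<epsilon> = x" using inj_onD[OF inj _ y x] by blast
      then show "\<forall>k\<in>A. u k = 0" using lny[of _ \<epsilon>] \<epsilon>(2) by auto
    qed
  qed
qed

lemma basis_sets_monomial_map:
  assumes "A \<inter> B = {}" "finite H" "monomial_domain A H \<noteq> {}"
  shows "basis_sets A B (monomial_domain A H) (monomial_map A B r c) =
    {S. S \<subseteq> A \<union> B \<and> card S = card A \<and>
      (\<forall>u. (\<forall>s\<in>S. linear_part A r s u = 0) \<longrightarrow> (\<forall>k\<in>A. u k = 0))}"
  unfolding basis_sets_def using inj_on_graph_coordinates_iff[OF assms] by blast

text \<open>On the hyperplane \<open>w i = \<beta>\<close> the terms containing \<open>w i\<close>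
  are constants and move into \<open>c\<close> and the bounds; no slope changes.\<close>

lemma log_cell_fix_coordinate:
  assumes "finite A" "i \<notin> A" "i \<notin> B"
  shows "w i = \<beta> \<and> w \<in> log_cell (insert i A) B r c H \<longleftrightarrow>
    w i = \<beta> \<and> w \<in> log_cell A B r (\<lambda>k. c k + r k i * \<beta>) ((\<lambda>(m, e). (m, e - m i * \<beta>)) ` H)"
  using assms by (auto simp: log_cell_def algebra_simps less_diff_eq)

text \<open>The exponents \<open>r'\<close> do not depend on \<open>b\<close>, which is what makes the basis sets of the slices agree.\<close>

lemma exp_cell_slice:
  assumes disj: "A \<inter> B = {}" and i: "i \<in> B" and j: "j \<in> A" and nz: "r i j \<noteq> 0"
    and rat: "rational_data r H"
  obtains r' c' H' where "\<And>b. rational_data r' (H' b)"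
    "\<And>b. b > 0 \<Longrightarrow> exp_cell A B r c H \<inter> {z. z $ i = b} =
      (\<lambda>z. z + b *\<^sub>R axis i 1) ` exp_cell (A - {j}) (insert j (B - {i})) r' (c' b) (H' b)"
proof -
  let ?A = "A - {j}" and ?B = "insert j (B - {i})"
  from log_cell_pivot[OF finite disj i j nz rat, of c] obtain r' c' H' where
    1: "rational_data r' H'" "log_cell A B r c H = log_cell (insert i ?A) ?B r' c' H'" .
  define c2 where "c2 b k = c' k + r' k i * ln b" for b k
  define H2 where "H2 b = (\<lambda>(m, e). (m, e - m i * ln b)) ` H'" for b
  have i': "i \<notin> ?A" "i \<notin> ?B" using disj i j by auto
  have D: "?A \<union> ?B = A \<union> B - {i}" using i j disj by auto
  have "exp_cell A B r c H \<inter> {z. z $ i = b} =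
      (\<lambda>z. z + b *\<^sub>R axis i 1) ` exp_cell ?A ?B r' (c2 b) (H2 b)" if b: "b > 0" for b
  proof -
    have fixed: "w i = ln b \<Longrightarrow> w \<in> log_cell A B r c H \<longleftrightarrow> w \<in> log_cell ?A ?B r' (c2 b) (H2 b)" for w
      using log_cell_fix_coordinate[OF finite i', of w "ln b" r' c' H']
      unfolding 1(2) c2_def H2_def by blast
    \<comment> \<open>The smaller cell does not read coordinate \<open>i\<close>, so restoring
      \<open>b\<close> there leaves membership unchanged.\<close>
    have eq: "(\<lambda>k. ln ((z + b *\<^sub>R axis i 1) $ k)) \<in> log_cell ?A ?B r' (c2 b) (H2 b) \<longleftrightarrow>
        (\<lambda>k. ln (z $ k)) \<in> log_cell ?A ?B r' (c2 b) (H2 b)" for z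
      by (rule log_cell_cong) (use i' in \<open>auto simp: axis_def\<close>)
    have mem: "z + b *\<^sub>R axis i 1 \<in> exp_cell A B r c H \<longleftrightarrow> z \<in> exp_cell ?A ?B r' (c2 b) (H2 b)"
      if z: "z $ i = 0" for z
    proof -
      have "(\<lambda>k. ln ((z + b *\<^sub>R axis i 1) $ k)) \<in> log_cell A B r c H \<longleftrightarrow>
          (\<lambda>k. ln (z $ k)) \<in> log_cell ?A ?B r' (c2 b) (H2 b)"
        by (rule trans[OF fixed eq]) (simp add: z)
      then show ?thesis
        unfolding exp_cell_def D using i b z by (auto simp: coord_space_def axis_def)
    qed
    show ?thesis
    proof (intro equalityI subsetI)
      fix z assume z: "z \<in> exp_cell A B r c H \<inter> {z. z $ i = b}"
      then have "z - b *\<^sub>R axis i 1 \<in> exp_cell ?A ?B r' (c2 b) (H2 b)"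
        using mem[of "z - b *\<^sub>R axis i 1"] by simp
      then show "z \<in> (\<lambda>z. z + b *\<^sub>R axis i 1) ` exp_cell ?A ?B r' (c2 b) (H2 b)"
        by (intro image_eqI[of _ _ "z - b *\<^sub>R axis i 1"]) auto
    next
      fix z assume "z \<in> (\<lambda>z. z + b *\<^sub>R axis i 1) ` exp_cell ?A ?B r' (c2 b) (H2 b)"
      then obtain v where v: "v \<in> exp_cell ?A ?B r' (c2 b) (H2 b)" "z = v + b *\<^sub>R axis i 1" by auto
      then have "v $ i = 0" using i' by (auto simp: exp_cell_def coord_space_def)
      then show "z \<in> exp_cell A B r c H \<inter> {z. z $ i = b}" using mem v by auto
    qed
  qed
  moreover have "rational_data r' (H2 b)" for b
    using 1(1) unfolding rational_data_def H2_def by fastforce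
  ultimately show thesis using that by blast
qed

section \<open>Induction over the number of independent coordinates\<close>

lemma monotone_monomial_map:
  assumes "A \<inter> B = {}" "bounded (exp_cell A B r c H)" "exp_cell A B r c H \<noteq> {}" "rational_data r H"
  shows "monotone_map A B (monomial_domain A H) (monomial_map A B r c)"
  using assms
\<comment> \<open>A slice has other independent coordinates, slopes, constants and inequalities, so
  all of these are generalized.\<close>
proof (induction "card A" arbitrary: A B r c H rule: less_induct)
  case less
  note disj = less.prems(1) and bdd = less.prems(2) and ne = less.prems(3) and rat = less.prems(4)
  let ?X = "monomial_domain A H" and ?f = "monomial_map A B r c"
  note graph = map_graph_monomial_map[OF disj, of H r c]
  show ?case
  proof (cases "card A = 0 \<or> card A = 1")
    case True
    then show ?thesis
      using admissible_monomial_map[OF disj bdd ne rat] monotone_function_monomial_map[OF disj bdd ne rat]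
      unfolding monotone_map.simps[of A B] by auto
  next
    case False
    have "\<exists>Y g.
          (\<forall>b. map_graph ?X ?f \<inter> {z. z $ i = b} \<noteq> {} \<longrightarrow>
             monotone_map (A - {j}) (insert j (B - {i})) (Y b) (g b) \<and>
             map_graph ?X ?f \<inter> {z. z $ i = b} =
               (\<lambda>z. z + b *\<^sub>R axis i 1) ` map_graph (Y b) (g b)) \<and>
          (\<forall>b b'. map_graph ?X ?f \<inter> {z. z $ i = b} \<noteq> {} \<and>
                  map_graph ?X ?f \<inter> {z. z $ i = b'} \<noteq> {} \<longrightarrow>
             basis_sets (A - {j}) (insert j (B - {i})) (Y b) (g b) =
             basis_sets (A - {j}) (insert j (B - {i})) (Y b') (g b'))"
      if i: "i \<in> B" and j: "j \<in> A" and dep: "\<not> independent_of ?X (\<lambda>x. ?f x $ i) j" for i j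
    proof -
      let ?A = "A - {j}" and ?B = "insert j (B - {i})"
      have nz: "r i j \<noteq> 0" using dep independent_of_monomial_map[OF i] by blast
      obtain r' c' H' where rat': "\<And>b. rational_data r' (H' b)" and slice:
        "\<And>b. b > 0 \<Longrightarrow> exp_cell A B r c H \<inter> {z. z $ i = b} =
          (\<lambda>z. z + b *\<^sub>R axis i 1) ` exp_cell ?A ?B r' (c' b) (H' b)"
        using exp_cell_slice[where c = c, OF disj i j nz rat] by metis
      define Y where "Y b = monomial_domain ?A (H' b)" for b
      define g where "g b = monomial_map ?A ?B r' (c' b)" for b
      have disj': "?A \<inter> ?B = {}" using disj by auto
      have graph': "map_graph (Y b) (g b) = exp_cell ?A ?B r' (c' b) (H' b)" for b
        unfolding Y_def g_def by (rule map_graph_monomial_map[OF disj'])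
      \<comment> \<open>Coordinates of a cell are positive, so a non-empty slice lies at a level
        where \<open>ln b\<close> makes sense; at all other levels the requirements are
        vacuous.\<close>
      have pos: "b > 0" if "map_graph ?X ?f \<inter> {z. z $ i = b} \<noteq> {}" for b
        using that i unfolding graph by (auto simp: exp_cell_def)
      have ne': "exp_cell ?A ?B r' (c' b) (H' b) \<noteq> {}"
        if "map_graph ?X ?f \<inter> {z. z $ i = b} \<noteq> {}" for b
        using that slice[OF pos[OF that]] unfolding graph by auto
      have bdd': "bounded (exp_cell ?A ?B r' (c' b) (H' b))" if "b > 0" for b
      proof (rule bounded_subset)
        show "bounded ((\<lambda>z. - (b *\<^sub>R axis i 1) + z) ` exp_cell A B r c H)"
          by (rule bounded_translation[OF bdd])
        show "exp_cell ?A ?B r' (c' b) (H' b) \<subseteq> (\<lambda>z. - (b *\<^sub>R axis i 1) + z) ` exp_cell A B r c H"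
        proof
          fix z assume "z \<in> exp_cell ?A ?B r' (c' b) (H' b)"
          then have "z + b *\<^sub>R axis i 1 \<in> exp_cell A B r c H" using slice[OF that] by blast
          then show "z \<in> (\<lambda>z. - (b *\<^sub>R axis i 1) + z) ` exp_cell A B r c H"
            by (intro image_eqI[of _ _ "z + b *\<^sub>R axis i 1"]) auto
        qed
      qed
      have "card ?A < card A" using j by (intro psubset_card_mono) auto
      then have "monotone_map ?A ?B (Y b) (g b)"
        if "map_graph ?X ?f \<inter> {z. z $ i = b} \<noteq> {}" for b
        unfolding Y_def g_def using disj' bdd'[OF pos[OF that]] ne'[OF that] rat'
        by (rule less.hyps)
      moreover have "map_graph ?X ?f \<inter> {z. z $ i = b} = (\<lambda>z. z + b *\<^sub>R axis i 1) ` map_graph (Y b) (g b)"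
        if "map_graph ?X ?f \<inter> {z. z $ i = b} \<noteq> {}" for b
        using slice[OF pos[OF that]] unfolding graph graph' .
      \<comment> \<open>The right-hand side does not mention \<open>b\<close>, so any two non-empty
        slices have the same basis sets.\<close>
      moreover have "basis_sets ?A ?B (Y b) (g b) =
          {S. S \<subseteq> ?A \<union> ?B \<and> card S = card ?A \<and>
            (\<forall>u. (\<forall>s\<in>S. linear_part ?A r' s u = 0) \<longrightarrow> (\<forall>k\<in>?A. u k = 0))}"
        if "map_graph ?X ?f \<inter> {z. z $ i = b} \<noteq> {}" for b
        unfolding Y_def g_def
      proof (rule basis_sets_monomial_map[OF disj'])
        show "finite (H' b)" using rat' by (auto simp: rational_data_def)
        show "monomial_domain ?A (H' b) \<noteq> {}"
          using ne'[OF that] unfolding graph'[symmetric] map_graph_def Y_def by blast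
      qed
      ultimately show ?thesis by (intro exI[of _ Y] exI[of _ g]) simp
    qed
    then show ?thesis
      using False admissible_monomial_map[OF disj bdd ne rat]
      unfolding monotone_map.simps[of A B] by auto
  qed
qed

section \<open>The toric cube as an exponential cell\<close>

theorem theorem6p2:
  fixes a :: "'n::finite \<Rightarrow> nat^'d::finite"
  shows "graph_of_monotone_map (open_toric_cube a)"
proof -
  define M where "M i j = real (a i $ j)" for i j
  have "M i j \<in> \<rat>" for i j by (simp add: M_def)
  then obtain A r c H where rat: "rational_data r H" and cell:
    "{w. \<exists>t. (\<forall>j. t j < 0) \<and> (\<forall>i. w i = (\<Sum>j\<in>UNIV. M i j * t j))} = log_cell A (- A) r c H"
    by (rule negative_orthant_image_log_cell)
  have ln_toric: "toric_map a t $ i > 0 \<and> ln (toric_map a t $ i) = (\<Sum>j\<in>UNIV. M i j * ln (t $ j))"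
    if "\<forall>j. 0 < t $ j" for t i
  proof -
    have "ln (toric_map a t $ i) = (\<Sum>j\<in>UNIV. ln (t $ j ^ (a i $ j)))"
      using that by (simp add: toric_map_def ln_prod less_imp_neq[symmetric])
    also have "\<dots> = (\<Sum>j\<in>UNIV. M i j * ln (t $ j))"
      using that by (intro sum.cong) (auto simp: ln_realpow M_def)
    finally show ?thesis using that by (auto simp: toric_map_def intro: prod_pos)
  qed
  have cube: "open_toric_cube a = exp_cell A (- A) r c H"
  proof (intro equalityI subsetI)
    fix z assume "z \<in> open_toric_cube a"
    then obtain t where t: "\<forall>j. 0 < t $ j \<and> t $ j < 1" and z: "z = toric_map a t"
      unfolding open_toric_cube_def by blast
    have "(\<lambda>k. ln (z $ k)) \<in> log_cell A (- A) r c H"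
      unfolding cell[symmetric] using t ln_toric[of t] by (auto simp: z intro!: exI[of _ "\<lambda>j. ln (t $ j)"])
    then show "z \<in> exp_cell A (- A) r c H"
      using t ln_toric[of t] by (auto simp: exp_cell_def coord_space_def z)
  next
    fix z assume z: "z \<in> exp_cell A (- A) r c H"
    then have "(\<lambda>k. ln (z $ k)) \<in> log_cell A (- A) r c H" and pos: "\<And>k. z $ k > 0"
      by (auto simp: exp_cell_def)
    then obtain \<tau> where \<tau>: "\<And>j. \<tau> j < 0" "\<And>i. ln (z $ i) = (\<Sum>j\<in>UNIV. M i j * \<tau> j)"
      unfolding cell[symmetric] by blast
    define t :: "real^'d" where "t = (\<chi> j. exp (\<tau> j))"
    have t: "\<forall>j. 0 < t $ j \<and> t $ j < 1" using \<tau>(1) by (simp add: t_def)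
    have "ln (z $ i) = ln (toric_map a t $ i)" for i
      using ln_toric[of t i] t \<tau>(2) by (simp add: t_def)
    then have "z = toric_map a t"
      using pos ln_toric[of t] t by (metis ln_inj_iff vec_eq_iff)
    then show "z \<in> open_toric_cube a" using t by (auto simp: open_toric_cube_def)
  qed
  \<comment> \<open>All logarithms are at most 0, because nonnegative exponents multiply negative
    parameters.\<close>
  have "bounded (exp_cell A (- A) r c H)"
  proof (rule bounded_exp_cell)
    fix w k assume "w \<in> log_cell A (- A) r c H"
    then obtain t where "\<forall>j. t j < 0" "w k = (\<Sum>j\<in>UNIV. M k j * t j)"
      unfolding cell[symmetric] by blast
    then show "w k \<le> 0"
      by (simp only:) (intro sum_nonpos mult_nonneg_nonpos; simp add: M_def less_imp_le)
  qed
  moreover have "exp_cell A (- A) r c H \<noteq> {}"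
  proof -
    have "toric_map a (\<chi> j. 1 / 2) \<in> open_toric_cube a" by (simp add: open_toric_cube_def)
    then show ?thesis using cube by auto
  qed
  ultimately have "monotone_map A (- A) (monomial_domain A H) (monomial_map A (- A) r c)"
    using rat by (intro monotone_monomial_map) auto
  moreover have "open_toric_cube a = map_graph (monomial_domain A H) (monomial_map A (- A) r c)"
    by (simp add: cube map_graph_monomial_map)
  ultimately show ?thesis unfolding graph_of_monotone_map_def by blast
qed

end
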